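(* Let $f\in\mathcal{O}_2$ define an isolated hypersurface singularity at $0\in\mathbb{C}^2$, and let $m=\nu(f)\geq 1$. Then for every integer $k\ge 0$, $$\mu^k(f)=\begin{cases}\mu(f)+k(k+1), & \text{if } 0\le k<m,\\[4pt] \mu(f)+k(k+1)-\dfrac{(k-m+2)(k-m+1)}{2}, & \text{if } k\ge m.\end{cases}$$
   Context: $\mathcal{O}_2=\mathbb{C}\{x,y\}$ is the ring of germs of holomorphic functions at $0\in\mathbb{C}^2$, $\mathfrak{m}$ is its maximal ideal, and $\mathfrak{m}^0=\mathcal{O}_2$. $\nu(f)$ is the algebraic multiplicity (order of vanishing) of $f$ at $0$. With $j(f)=\langle f_x,f_y\rangle$, the $k$-th Milnor number is $\mu^k(f)=\dim_{\mathbb{C}}\mathcal{O}_2/(\mathfrak{m}^k j(f))$ for $k\ge0$, and $\mu(f)=\mu^0(f)=\dim_{\mathbb{C}}\mathcal{O}_2/j(f)$ is the Milnor number. *)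

theory Defs
  imports
    "HOL-Analysis.Analysis"
    "HOL-Computational_Algebra.Formal_Power_Series"
    "HOL-Algebra.Ideal_Product"
    "HOL-Algebra.QuotRing"
    "HOL-Algebra.Embedded_Algebras"
begin

text \<open>
  A power series in two variables is an element of \<open>complex fps fps\<close>: the outer variable is
  \<open>x\<close> and the inner one is \<open>y\<close>, so that \<open>f\<close> is the sum of all
  \<open>coeff2 f i j * x ^ i * y ^ j\<close>.
\<close>

definition coeff2 :: "complex fps fps \<Rightarrow> nat \<Rightarrow> nat \<Rightarrow> complex" where
  "coeff2 f i j = fps_nth (fps_nth f i) j"

definition const2 :: "complex \<Rightarrow> complex fps fps" where
  "const2 c = fps_const (fps_const c)"

definition convergent2 :: "complex fps fps \<Rightarrow> bool" where
  "convergent2 f \<longleftrightarrow>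
     (\<exists>r>0. (\<lambda>(i, j). norm (coeff2 f i j) * r ^ i * r ^ j) summable_on (UNIV :: (nat \<times> nat) set))"

text \<open>
  The ring of germs at the origin is taken in its presentation \<open>\<complex>{x,y}\<close>: a germ
  is given by its convergent Taylor series.
\<close>

definition O2 :: "complex fps fps ring" where
  "O2 = \<lparr>carrier = {f. convergent2 f}, mult = (*), one = 1, zero = 0, add = (+)\<rparr>"

text \<open>
  The value of the germ at a point; only meaningful for points close enough to the origin
  for the series to converge.
\<close>

definition eval2 :: "complex fps fps \<Rightarrow> complex \<times> complex \<Rightarrow> complex" where
  "eval2 f p = (\<Sum>\<^sub>\<infinity>(i, j)\<in>UNIV. coeff2 f i j * fst p ^ i * snd p ^ j)"

definition deriv_x :: "complex fps fps \<Rightarrow> complex fps fps" where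
  "deriv_x f = fps_deriv f"

definition deriv_y :: "complex fps fps \<Rightarrow> complex fps fps" where
  "deriv_y f = Abs_fps (\<lambda>i. fps_deriv (fps_nth f i))"

definition max_ideal :: "complex fps fps set" where
  "max_ideal = {f \<in> carrier O2. coeff2 f 0 0 = 0}"

text \<open>The multiplicity is the least degree of a monomial occurring in \<open>f\<close>, and \<open>\<infinity>\<close> for \<open>f = 0\<close>.\<close>

definition multiplicity0 :: "complex fps fps \<Rightarrow> enat" where
  "multiplicity0 f = Inf {enat (i + j) | i j. coeff2 f i j \<noteq> 0}"

text \<open>
  The germ of the curve \<open>f = 0\<close> passes through the origin and has no singular point other
  than possibly the origin itself; a smooth germ is allowed.
\<close>

definition isolated_singularity :: "complex fps fps \<Rightarrow> bool" where
  "isolated_singularity f \<longleftrightarrow>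
     f \<in> carrier O2 \<and> eval2 f (0, 0) = 0 \<and>
     (\<forall>\<^sub>F p in at (0, 0). \<not> (eval2 f p = 0 \<and> eval2 (deriv_x f) p = 0 \<and> eval2 (deriv_y f) p = 0))"

definition jacobian_ideal :: "complex fps fps \<Rightarrow> complex fps fps set" where
  "jacobian_ideal f = Idl\<^bsub>O2\<^esub> {deriv_x f, deriv_y f}"

text \<open>
  The dimension over the complex numbers of the quotient of \<open>O2\<close> by an ideal. The complex
  numbers act on the quotient through the classes of the constant series. For \<open>I = carrier O2\<close>
  the quotient is the zero ring and the dimension is \<open>0\<close>.
\<close>

definition quot_dim :: "complex fps fps set \<Rightarrow> enat" where
  "quot_dim I =
     (let Q = O2 Quot I; K = range (\<lambda>c. I +>\<^bsub>O2\<^esub> const2 c)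
      in if ring.finite_dimension Q K (carrier Q) then enat (ring.dim Q K (carrier Q)) else \<infinity>)"

text \<open>In the monoid of ideals the zeroth power is the whole ring.\<close>

definition milnor_number_k :: "nat \<Rightarrow> complex fps fps \<Rightarrow> enat" where
  "milnor_number_k k f =
     quot_dim ((max_ideal [^]\<^bsub>ideals_set O2\<^esub> k) \<cdot>\<^bsub>O2\<^esub> jacobian_ideal f)"

definition milnor_number :: "complex fps fps \<Rightarrow> enat" where
  "milnor_number f = quot_dim (jacobian_ideal f)"


subsection \<open>Consistency of the definitions\<close>

lemma coeff2_simps [simp]:
  "coeff2 (f + g) i j = coeff2 f i j + coeff2 g i j"
  "coeff2 (- f) i j = - coeff2 f i j"
  "coeff2 0 i j = 0"
  "coeff2 (const2 c) i j = (if i = 0 \<and> j = 0 then c else 0)"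
  "coeff2 (deriv_x f) i j = of_nat (i + 1) * coeff2 f (i + 1) j"
  "coeff2 (deriv_y f) i j = of_nat (j + 1) * coeff2 f i (j + 1)"
  by (simp_all add: coeff2_def const2_def deriv_x_def deriv_y_def algebra_simps)

lemma coeff2_mult:
  "coeff2 (f * g) i j = (\<Sum>a=0..i. \<Sum>b=0..j. coeff2 f a b * coeff2 g (i - a) (j - b))"
  by (simp add: coeff2_def fps_mult_nth fps_sum_nth)

lemma const2_1: "const2 1 = 1"
  by (simp add: const2_def)

lemma convergent2_iff_bounded:
  "convergent2 f \<longleftrightarrow> (\<exists>C R. R > 0 \<and> (\<forall>i j. norm (coeff2 f i j) \<le> C * R ^ (i + j)))"
proof
  assume "convergent2 f"
  then obtain r where r: "r > 0"
    and s: "(\<lambda>(i, j). norm (coeff2 f i j) * r ^ i * r ^ j) summable_on (UNIV :: (nat \<times> nat) set)"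
    unfolding convergent2_def by blast
  define S where "S = infsum (\<lambda>(i, j). norm (coeff2 f i j) * r ^ i * r ^ j) (UNIV :: (nat \<times> nat) set)"
  have "norm (coeff2 f i j) \<le> S * (1 / r) ^ (i + j)" for i j
  proof -
    have "sum (\<lambda>(i, j). norm (coeff2 f i j) * r ^ i * r ^ j) {(i, j)} \<le> S"
      unfolding S_def by (rule finite_sum_le_infsum[OF s]) (use r in auto)
    then show ?thesis using r by (simp add: field_simps power_add)
  qed
  then show "\<exists>C R. R > 0 \<and> (\<forall>i j. norm (coeff2 f i j) \<le> C * R ^ (i + j))"
    using r by (intro exI[of _ S] exI[of _ "1 / r"]) auto
next
  assume "\<exists>C R. R > 0 \<and> (\<forall>i j. norm (coeff2 f i j) \<le> C * R ^ (i + j))"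
  then obtain C R where R: "R > 0" and b: "\<And>i j. norm (coeff2 f i j) \<le> C * R ^ (i + j)"
    by blast
  define r where "r = 1 / (2 * R)"
  have g: "(\<lambda>n. (1 / 2 :: real) ^ n) summable_on UNIV"
    by (rule norm_summable_imp_summable_on) simp
  have "(\<lambda>(i, j). (1 / 2 :: real) ^ i * (1 / 2) ^ j) summable_on (UNIV \<times> UNIV)"
  proof (rule summable_on_SigmaI)
    show "((\<lambda>j. case (i, j) of (i, j) \<Rightarrow> (1 / 2 :: real) ^ i * (1 / 2) ^ j) has_sum
        (1 / 2) ^ i * (\<Sum>\<^sub>\<infinity>j. (1 / 2) ^ j)) UNIV" for i
      using has_sum_cmult_right[OF has_sum_infsum[OF g]] by simp
    show "(\<lambda>i. (1 / 2 :: real) ^ i * (\<Sum>\<^sub>\<infinity>j. (1 / 2) ^ j)) summable_on UNIV"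
      by (rule summable_on_cmult_left[OF g])
  qed auto
  then have "(\<lambda>(i, j). C * ((1 / 2 :: real) ^ i * (1 / 2) ^ j)) summable_on (UNIV \<times> UNIV)"
    using summable_on_cmult_right[of "\<lambda>(i, j). (1 / 2 :: real) ^ i * (1 / 2) ^ j" "UNIV \<times> UNIV" C]
    by (simp add: case_prod_unfold)
  then have "(\<lambda>(i, j). norm (coeff2 f i j) * r ^ i * r ^ j) summable_on (UNIV \<times> UNIV)"
  proof (rule summable_on_comparison_test)
    fix p :: "nat \<times> nat"
    obtain i j where p: "p = (i, j)" by (cases p)
    have "norm (coeff2 f i j) * (r ^ i * r ^ j) \<le> C * R ^ (i + j) * (r ^ i * r ^ j)"
      using b R by (intro mult_right_mono) (auto simp: r_def)
    also have "\<dots> = C * ((R * r) ^ i * (R * r) ^ j)"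
      by (simp add: power_add power_mult_distrib)
    also have "R * r = 1 / 2" using R by (simp add: r_def)
    finally show "(case p of (i, j) \<Rightarrow> norm (coeff2 f i j) * r ^ i * r ^ j)
        \<le> (case p of (i, j) \<Rightarrow> C * ((1 / 2) ^ i * (1 / 2) ^ j))"
      using p by (simp add: mult.assoc)
  qed (use R in \<open>auto simp: r_def\<close>)
  then show "convergent2 f"
    unfolding convergent2_def using R by (intro exI[of _ r]) (auto simp: r_def)
qed

lemma convergent2I:
  assumes "R > 0" "\<And>i j. norm (coeff2 f i j) \<le> C * R ^ (i + j)"
  shows "convergent2 f"
  using assms convergent2_iff_bounded by blast

lemma convergent2E:
  assumes "convergent2 f"
  obtains C R where "C \<ge> 0" "R \<ge> 1" "\<And>i j. norm (coeff2 f i j) \<le> C * R ^ (i + j)"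
proof -
  obtain C R where R: "R > 0" and b: "\<And>i j. norm (coeff2 f i j) \<le> C * R ^ (i + j)"
    using assms convergent2_iff_bounded by blast
  have C: "C \<ge> 0" using order_trans[OF norm_ge_zero b[of 0 0]] by simp
  have "norm (coeff2 f i j) \<le> C * max 1 R ^ (i + j)" for i j
    by (rule order_trans[OF b]) (use C R in \<open>auto intro!: mult_left_mono power_mono\<close>)
  then show ?thesis using that[of C "max 1 R"] C by simp
qed

lemma Suc_le_two_power: "real n + 1 \<le> 2 ^ n"
  by (induction n) auto

lemma convergent2_const2: "convergent2 (const2 c)"
  by (rule convergent2I[of 1 _ "norm c"]) auto

lemma convergent2_uminus: "convergent2 f \<Longrightarrow> convergent2 (- f)"
  by (simp add: convergent2_def)

lemma convergent2_add:
  assumes "convergent2 f" "convergent2 g" shows "convergent2 (f + g)"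
proof -
  obtain C R where 1: "C \<ge> 0" "R \<ge> 1" "\<And>i j. norm (coeff2 f i j) \<le> C * R ^ (i + j)"
    using convergent2E[OF assms(1)] by blast
  obtain D S where 2: "D \<ge> 0" "S \<ge> 1" "\<And>i j. norm (coeff2 g i j) \<le> D * S ^ (i + j)"
    using convergent2E[OF assms(2)] by blast
  show ?thesis
  proof (rule convergent2I[of "max R S" _ "C + D"])
    fix i j
    have "norm (coeff2 f i j) \<le> C * max R S ^ (i + j)"
      by (rule order_trans[OF 1(3)]) (use 1 in \<open>auto intro!: mult_left_mono power_mono\<close>)
    moreover have "norm (coeff2 g i j) \<le> D * max R S ^ (i + j)"
      by (rule order_trans[OF 2(3)]) (use 2 in \<open>auto intro!: mult_left_mono power_mono\<close>)
    ultimately show "norm (coeff2 (f + g) i j) \<le> (C + D) * max R S ^ (i + j)"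
      using norm_triangle_ineq[of "coeff2 f i j" "coeff2 g i j"] by (simp add: distrib_right)
  qed (use 1 in auto)
qed

lemma convergent2_mult:
  assumes "convergent2 f" "convergent2 g" shows "convergent2 (f * g)"
proof -
  obtain C R where 1: "C \<ge> 0" "R \<ge> 1" "\<And>i j. norm (coeff2 f i j) \<le> C * R ^ (i + j)"
    using convergent2E[OF assms(1)] by blast
  obtain D S where 2: "D \<ge> 0" "S \<ge> 1" "\<And>i j. norm (coeff2 g i j) \<le> D * S ^ (i + j)"
    using convergent2E[OF assms(2)] by blast
  define M where "M = max R S"
  have M: "M \<ge> 1" using 1 by (simp add: M_def)
  show ?thesis
  proof (rule convergent2I[of "2 * M" _ "C * D"])
    fix i j
    have t: "norm (coeff2 f a b * coeff2 g (i - a) (j - b)) \<le> C * D * M ^ (i + j)"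
      if "a \<in> {0..i}" "b \<in> {0..j}" for a b
    proof -
      have "norm (coeff2 f a b) \<le> C * M ^ (a + b)"
        by (rule order_trans[OF 1(3)]) (use 1 in \<open>auto intro!: mult_left_mono power_mono simp: M_def\<close>)
      moreover have "norm (coeff2 g (i - a) (j - b)) \<le> D * M ^ ((i - a) + (j - b))"
        by (rule order_trans[OF 2(3)]) (use 2 in \<open>auto intro!: mult_left_mono power_mono simp: M_def\<close>)
      ultimately have "norm (coeff2 f a b * coeff2 g (i - a) (j - b))
          \<le> (C * M ^ (a + b)) * (D * M ^ ((i - a) + (j - b)))"
        unfolding norm_mult by (intro mult_mono) (use 1 M in auto)
      also have "\<dots> = C * D * M ^ ((a + b) + ((i - a) + (j - b)))"
        by (simp add: power_add)
      also have "(a + b) + ((i - a) + (j - b)) = i + j" using that by auto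
      finally show ?thesis .
    qed
    have "norm (coeff2 (f * g) i j) \<le> (\<Sum>a=0..i. \<Sum>b=0..j. C * D * M ^ (i + j))"
      unfolding coeff2_mult by (intro sum_norm_le t)
    also have "\<dots> = (real i + 1) * (real j + 1) * (C * D * M ^ (i + j))"
      by (simp add: algebra_simps)
    also have "\<dots> \<le> (2 ^ i * 2 ^ j) * (C * D * M ^ (i + j))"
      using 1 2 M by (intro mult_right_mono mult_mono Suc_le_two_power) auto
    finally show "norm (coeff2 (f * g) i j) \<le> C * D * (2 * M) ^ (i + j)"
      by (simp add: power_add power_mult_distrib mult_ac)
  qed (use M in auto)
qed

lemma convergent2_deriv:
  assumes "convergent2 f" shows "convergent2 (deriv_x f)" "convergent2 (deriv_y f)"
proof -
  obtain C R where 1: "C \<ge> 0" "R \<ge> 1" "\<And>i j. norm (coeff2 f i j) \<le> C * R ^ (i + j)"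
    using convergent2E[OF assms] by blast
  have e: "(real n + 1) * (C * R ^ (i + j + 1)) \<le> C * R * (2 * R) ^ (i + j)"
    if "n \<le> i + j" for n i j
  proof -
    have "real n + 1 \<le> real (i + j) + 1" using that by simp
    also have "\<dots> \<le> 2 ^ (i + j)" by (rule Suc_le_two_power)
    finally have "(real n + 1) * (C * R ^ (i + j + 1)) \<le> 2 ^ (i + j) * (C * R ^ (i + j + 1))"
      using 1 by (intro mult_right_mono) auto
    then show ?thesis by (simp add: power_mult_distrib mult_ac)
  qed
  have n: "norm (of_nat (n + 1) * z :: complex) = (real n + 1) * norm z" for n z
    unfolding norm_mult norm_of_nat by simp
  show "convergent2 (deriv_x f)"
  proof (rule convergent2I[of "2 * R" _ "C * R"])
    fix i j
    have "norm (coeff2 (deriv_x f) i j) = (real i + 1) * norm (coeff2 f (i + 1) j)"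
      using n by simp
    also have "\<dots> \<le> (real i + 1) * (C * R ^ (i + j + 1))"
      using 1(3)[of "i + 1" j] by (intro mult_left_mono) (auto simp: add_ac)
    also have "\<dots> \<le> C * R * (2 * R) ^ (i + j)" by (rule e) simp
    finally show "norm (coeff2 (deriv_x f) i j) \<le> C * R * (2 * R) ^ (i + j)" .
  qed (use 1 in auto)
  show "convergent2 (deriv_y f)"
  proof (rule convergent2I[of "2 * R" _ "C * R"])
    fix i j
    have "norm (coeff2 (deriv_y f) i j) = (real j + 1) * norm (coeff2 f i (j + 1))"
      using n by simp
    also have "\<dots> \<le> (real j + 1) * (C * R ^ (i + j + 1))"
      using 1(3)[of i "j + 1"] by (intro mult_left_mono) (auto simp: add_ac)
    also have "\<dots> \<le> C * R * (2 * R) ^ (i + j)" by (rule e) simp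
    finally show "norm (coeff2 (deriv_y f) i j) \<le> C * R * (2 * R) ^ (i + j)" .
  qed (use 1 in auto)
qed

lemma O2_simps [simp]:
  "f \<in> carrier O2 \<longleftrightarrow> convergent2 f"
  "mult O2 = (*)" "one O2 = 1" "zero O2 = 0" "add O2 = (+)"
  by (simp_all add: O2_def)

lemma cring_O2: "cring O2"
proof (rule cringI)
  show "abelian_group O2"
  proof (rule abelian_groupI)
    show "\<exists>y\<in>carrier O2. y \<oplus>\<^bsub>O2\<^esub> x = \<zero>\<^bsub>O2\<^esub>" if "x \<in> carrier O2" for x
      using that by (intro bexI[of _ "- x"]) (auto intro: convergent2_uminus)
  qed (use convergent2_const2[of 0] in \<open>auto intro: convergent2_add simp: algebra_simps const2_def\<close>)
  show "comm_monoid O2"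
    by (rule comm_monoidI)
      (use convergent2_const2[of 1] in \<open>auto intro: convergent2_mult simp: algebra_simps const2_def\<close>)
qed (auto simp: algebra_simps)

lemma maximalideal_max_ideal: "maximalideal max_ideal O2"
proof -
  interpret cring O2 by (rule cring_O2)
  have id: "ideal max_ideal O2"
  proof (rule idealI)
    show "subgroup max_ideal (add_monoid O2)"
    proof (rule add.subgroupI)
      fix a assume a: "a \<in> max_ideal"
      then have "\<ominus>\<^bsub>O2\<^esub> a = - a"
        by (intro minus_equality) (auto simp: max_ideal_def convergent2_uminus)
      then show "\<ominus>\<^bsub>O2\<^esub> a \<in> max_ideal"
        using a by (auto simp: max_ideal_def convergent2_uminus)
    next
      show "max_ideal \<noteq> {}"
        using zero_closed by (auto simp: max_ideal_def intro!: exI[of _ 0])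
    qed (auto simp: max_ideal_def convergent2_add)
  qed (auto simp: max_ideal_def convergent2_mult coeff2_mult ring_axioms)
  show ?thesis
  proof (rule maximalidealI[OF id])
    have "1 \<notin> max_ideal" using coeff2_simps(4)[of 1 0 0] by (auto simp: max_ideal_def const2_1)
    moreover have "1 \<in> carrier O2" using one_closed by simp
    ultimately show "carrier O2 \<noteq> max_ideal" by blast
  next
    fix J assume J: "ideal J O2" "max_ideal \<subseteq> J" "J \<subseteq> carrier O2"
    interpret J: ideal J O2 by (rule J(1))
    show "J = max_ideal \<or> J = carrier O2"
    proof (cases "J \<subseteq> max_ideal")
      case False
      then obtain f where f: "f \<in> J" "f \<notin> max_ideal" by blast
      define c where "c = coeff2 f 0 0"
      have cf: "convergent2 f" using f J by auto
      have c: "c \<noteq> 0" using f cf by (auto simp: max_ideal_def c_def)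
      have "const2 c + - f \<in> max_ideal"
        using cf by (auto simp: max_ideal_def c_def convergent2_add convergent2_const2 convergent2_uminus
            simp del: add_uminus_conv_diff)
      then have "(const2 c + - f) \<oplus>\<^bsub>O2\<^esub> f \<in> J" using J(2) f by (intro J.a_closed) auto
      then have "const2 c \<in> J" by simp
      then have "const2 (1 / c) \<otimes>\<^bsub>O2\<^esub> const2 c \<in> J"
        by (intro J.I_l_closed) (auto simp: convergent2_const2)
      then have "\<one>\<^bsub>O2\<^esub> \<in> J" using c by (simp add: const2_def)
      then show ?thesis using J.one_imp_carrier by blast
    qed (use J in blast)
  qed
qed

lemma ideal_jacobian_ideal:
  assumes "f \<in> carrier O2" shows "ideal (jacobian_ideal f) O2"
proof -
  interpret cring O2 by (rule cring_O2)
  show ?thesis unfolding jacobian_ideal_def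
    by (rule genideal_ideal) (use assms convergent2_deriv in auto)
qed

lemma milnor_number_k_0:
  assumes "f \<in> carrier O2" shows "milnor_number_k 0 f = milnor_number f"
proof -
  interpret cring O2 by (rule cring_O2)
  have "carrier O2 \<cdot>\<^bsub>O2\<^esub> jacobian_ideal f = jacobian_ideal f"
    using ideal_prod_one[OF ideal_jacobian_ideal[OF assms]]
      ideal_prod_commute[OF ideal_jacobian_ideal[OF assms] oneideal] by simp
  then show ?thesis
    by (simp add: milnor_number_k_def milnor_number_def ideals_set_def)
qed

end

theory Submission
  imports Defs
begin

text \<open>
  Let \<open>a\<close>, \<open>b\<close> be the partial derivatives, \<open>J\<close> the ideal they generate, \<open>M\<close> the \<open>k\<close>-th power of the
  maximal ideal. If \<open>J\<close> has infinite codimension, so has \<open>MJ\<close>, and both sides are \<open>\<infinity>\<close>. Otherwise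
  it remains to compute the dimension of \<open>J / MJ\<close>, which by the map \<open>(g, h) \<mapsto> g a + h b\<close> is the
  quotient of the square of \<open>O2 / M\<close>, of dimension \<open>k (k + 1)\<close>, by the image of the syzygies of
  \<open>(a, b)\<close>. As soon as all syzygies are multiples of \<open>(b, - a)\<close>, this image is \<open>O2\<close> modulo
  \<open>{q. q a \<in> M \<and> q b \<in> M}\<close>, which is the power of the maximal ideal with exponent \<open>k - (m - 1)\<close>.

  That every syzygy is a multiple of \<open>(b, - a)\<close> follows from finite codimension alone, without
  unique factorization: \<open>J\<close> contains nonzero series \<open>P = \<alpha> a + \<beta> b\<close> in \<open>x\<close> only and
  \<open>Q = \<gamma> a + \<delta> b\<close> in \<open>y\<close> only. If \<open>g a + h b = 0\<close>, put \<open>r = \<beta> g - \<alpha> h\<close> and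
  \<open>s = \<delta> g - \<gamma> h\<close>; then \<open>g P = b r\<close>, \<open>h P = - a r\<close>, \<open>g Q = b s\<close>, \<open>h Q = - a s\<close>, so
  \<open>r Q = s P\<close>, hence \<open>P\<close> divides \<open>r\<close> and the quotient is the required factor.
\<close>

section \<open>Relative dimension of subspaces\<close>

text \<open>
  \<open>I\<close> has codimension \<open>n\<close> in \<open>W\<close>, witnessed by a chain of one-dimensional extensions; this
  mirrors the predicate \<open>dimension\<close> of \<open>HOL-Algebra\<close> in the quotient by \<open>I\<close>.
\<close>

inductive relative_dim :: "('a::field \<Rightarrow> 'v::ab_group_add \<Rightarrow> 'v) \<Rightarrow> 'v set \<Rightarrow> nat \<Rightarrow> 'v set \<Rightarrow> bool"
  for s I where
    relative_dim_0: "relative_dim s I 0 I"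
  | relative_dim_Suc: "relative_dim s I n E \<Longrightarrow> v \<notin> E \<Longrightarrow>
      relative_dim s I (Suc n) {s c v + e | c e. e \<in> E}"

inductive_cases relative_dim_SucE: "relative_dim s I (Suc n) W"

lemma relative_dim_trans:
  assumes "relative_dim s J n W" "relative_dim s I m J"
  shows "relative_dim s I (m + n) W"
  using assms by (induction rule: relative_dim.induct) (auto intro: relative_dim.intros)

section \<open>Line extensions and uniqueness of the relative codimension\<close>

context vector_space
begin

lemma subspace_line_extension:
  assumes "subspace E" shows "subspace {scale c v + e | c e. e \<in> E}"
proof -
  have "{scale c v + e | c e. e \<in> E} = {x + y | x y. x \<in> span {v} \<and> y \<in> E}"
    by (auto simp: span_singleton)
  then show ?thesis
    using subspace_sums[OF subspace_span assms] by simp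
qed

lemma subset_line_extension: "E \<subseteq> {scale c v + e | c e. e \<in> E}"
proof
  fix x assume "x \<in> E"
  then show "x \<in> {scale c v + e | c e. e \<in> E}"
    by (intro CollectI exI[of _ 0] exI[of _ x]) auto
qed

lemma mem_line_extension:
  assumes "subspace E" shows "v \<in> {scale c v + e | c e. e \<in> E}"
  using subspace_0[OF assms] by (intro CollectI exI[of _ 1] exI[of _ 0]) auto

lemma relative_dim_subspace:
  "relative_dim scale I n W \<Longrightarrow> subspace I \<Longrightarrow> subspace W"
  by (induction rule: relative_dim.induct) (auto intro: subspace_line_extension)

lemma relative_dim_subset: "relative_dim scale I n W \<Longrightarrow> I \<subseteq> W"
proof (induction rule: relative_dim.induct)
  case (relative_dim_Suc n E v)
  then show ?case using subset_line_extension[of E v] by blast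
qed auto

lemma scale_mem_iff:
  assumes "subspace E" "c \<noteq> 0" shows "scale c x \<in> E \<longleftrightarrow> x \<in> E"
  using subspace_scale[OF assms(1), of "scale c x" "inverse c"] subspace_scale[OF assms(1), of x c] assms(2)
  by auto

text \<open>The \<open>v\<close>-coefficient of \<open>w\<close> is nonzero because \<open>w\<close>
  lies outside \<open>E\<close>, so subtracting a suitable multiple of \<open>w\<close> moves any
  element of \<open>U\<close> into \<open>E\<close>: \<open>w\<close> can replace
  \<open>v\<close>.\<close>

lemma inter_line_extension:
  assumes E: "subspace E" and U: "subspace U" and w: "w \<in> U" "w \<notin> E"
    and le: "U \<subseteq> {scale c v + e | c e. e \<in> E}"
  shows "U = {scale c w + e | c e. e \<in> U \<inter> E}"
proof -
  obtain d e where d: "w = scale d v + e" "e \<in> E" using w le by blast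
  have d0: "d \<noteq> 0" using d w by auto
  have "u \<in> {scale c w + e | c e. e \<in> U \<inter> E}" if u: "u \<in> U" for u
  proof -
    obtain c e' where c: "u = scale c v + e'" "e' \<in> E" using u le by blast
    have "u - scale (c / d) w = e' - scale (c / d) e"
      using d0 by (simp add: c d(1) scale_right_distrib)
    moreover have "e' - scale (c / d) e \<in> E" "u - scale (c / d) w \<in> U"
      using c(2) d(2) u w(1) E U by (auto intro: subspace_diff subspace_scale)
    ultimately have "u - scale (c / d) w \<in> U \<inter> E" by simp
    moreover have "u = scale (c / d) w + (u - scale (c / d) w)" by simp
    ultimately show ?thesis by blast
  qed
  moreover have "{scale c w + e | c e. e \<in> U \<inter> E} \<subseteq> U"
    using U w by (auto intro!: subspace_add subspace_scale)
  ultimately show ?thesis by blast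
qed

text \<open>The chain that witnesses \<open>n\<close> may miss \<open>U \<inter> E\<close>, so it is
  rerouted through that hyperplane. This exchange makes the length of a chain independent of its
  choice.\<close>

lemma relative_dim_hyperplane:
  assumes "relative_dim scale I n U" "subspace I" "subspace E" "I \<subseteq> E"
    and "w \<in> U" "w \<notin> E" "U = {scale c w + e | c e. e \<in> U \<inter> E}"
  shows "\<exists>k. n = Suc k \<and> relative_dim scale I k (U \<inter> E)"
  using assms
proof (induction arbitrary: w rule: relative_dim.induct)
  case (relative_dim_Suc n F u)
  define U where "U = {scale c u + e | c e. e \<in> F}"
  have F: "subspace F" "I \<subseteq> F"
    using relative_dim_Suc relative_dim_subspace relative_dim_subset by auto
  have sU: "subspace U" unfolding U_def by (rule subspace_line_extension[OF F(1)])
  have FU: "F \<subseteq> U" unfolding U_def by (rule subset_line_extension)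
  have uU: "u \<in> U" unfolding U_def by (rule mem_line_extension[OF F(1)])
  have U_eq: "U = {scale c w + e | c e. e \<in> U \<inter> E}" and wU: "w \<in> U"
    using relative_dim_Suc.prems unfolding U_def by blast+
  have sUE: "subspace (U \<inter> E)" using sU relative_dim_Suc.prems by (auto intro: subspace_inter)
  show ?case unfolding U_def[symmetric]
  proof (cases "F \<subseteq> E")
    case True
    \<comment> \<open>An element of \<open>U \<inter> E\<close> outside \<open>F\<close> would force
      \<open>u\<close>, and with it all of \<open>U\<close>, into \<open>E\<close>, against the
      choice of \<open>w\<close>.\<close>
    have "U \<inter> E \<subseteq> F"
    proof
      fix x assume x: "x \<in> U \<inter> E"
      then obtain c e where c: "x = scale c u + e" "e \<in> F" unfolding U_def by blast
      show "x \<in> F"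
      proof (cases "c = 0")
        case False
        have "x - e \<in> E" using x c(2) True relative_dim_Suc.prems(2) by (blast intro: subspace_diff)
        then have "scale c u \<in> E" using c(1) by simp
        then have "u \<in> E" using False scale_mem_iff relative_dim_Suc.prems(2) by blast
        then have "U \<subseteq> E" using True relative_dim_Suc.prems(2)
          unfolding U_def by (auto intro!: subspace_add subspace_scale)
        then show ?thesis using wU relative_dim_Suc.prems by blast
      qed (use c in auto)
    qed
    then have "U \<inter> E = F" using True FU by blast
    then show "\<exists>k. Suc n = Suc k \<and> relative_dim scale I k (U \<inter> E)"
      using relative_dim_Suc by auto
  next
    case False
    then obtain f where f: "f \<in> F" "f \<notin> E" by blast
    have le: "U \<subseteq> {scale c w + e | c e. e \<in> E}"
      by (subst U_eq) blast
    have F_eq: "F = {scale c f + e | c e. e \<in> F \<inter> E}"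
      by (rule inter_line_extension[OF relative_dim_Suc.prems(2) F(1) f subset_trans[OF FU le]])
    have U_eq': "U = {scale c f + e | c e. e \<in> U \<inter> E}"
      using f FU by (intro inter_line_extension[OF relative_dim_Suc.prems(2) sU _ _ le]) auto
    from relative_dim_Suc.IH[OF relative_dim_Suc.prems(1-3) f F_eq]
    obtain k where k: "n = Suc k" "relative_dim scale I k (F \<inter> E)" by blast
    \<comment> \<open>Removing the \<open>f\<close>-component of \<open>u\<close> leaves a vector of
      \<open>E\<close> that is still outside \<open>F\<close>, because \<open>f \<in> F\<close>; it
      extends \<open>F \<inter> E\<close> to \<open>U \<inter> E\<close>.\<close>
    obtain c v where v: "u = scale c f + v" "v \<in> U \<inter> E" using uU by (subst (asm) U_eq') blast
    have vF: "v \<notin> F"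
      using v f relative_dim_Suc.hyps F by (auto simp: subspace_add subspace_scale)
    have "U \<inter> E = {scale c v + e | c e. e \<in> (U \<inter> E) \<inter> F}"
    proof (rule inter_line_extension[OF F(1) sUE v(2) vF])
      show "U \<inter> E \<subseteq> {scale c u + e | c e. e \<in> F}" unfolding U_def by blast
    qed
    moreover have "(U \<inter> E) \<inter> F = F \<inter> E" using FU by blast
    ultimately show "\<exists>k. Suc n = Suc k \<and> relative_dim scale I k (U \<inter> E)"
      using relative_dim.relative_dim_Suc[OF k(2), of v] vF k(1) by auto
  qed
qed auto

text \<open>Induction on the chain below \<open>W\<close>: its last member \<open>E\<close> either
  contains \<open>U\<close> or meets it in a hyperplane, in which case both chains lose one
  step.\<close>

lemma relative_dim_mono:
  assumes "relative_dim scale I n W" "relative_dim scale I n' U" "subspace I" "U \<subseteq> W"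
  shows "n' \<le> n"
  using assms
proof (induction arbitrary: n' U rule: relative_dim.induct)
  case relative_dim_0
  show ?case
  proof (cases n')
    case (Suc k)
    then obtain E v where E: "relative_dim scale I k E" "v \<notin> E" "U = {scale c v + e | c e. e \<in> E}"
      using relative_dim_0 by (auto elim: relative_dim_SucE)
    have "v \<in> U" unfolding E(3)
      by (rule mem_line_extension) (use E relative_dim_subspace relative_dim_0 in blast)
    then show ?thesis using relative_dim_subset[OF E(1)] E(2) relative_dim_0 by blast
  qed auto
next
  case (relative_dim_Suc n E v)
  have E: "subspace E" "I \<subseteq> E" and U: "subspace U"
    using relative_dim_Suc relative_dim_subspace relative_dim_subset by blast+
  show ?case
  proof (cases "U \<subseteq> E")
    case True
    then show ?thesis using relative_dim_Suc by fastforce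
  next
    case False
    then obtain w where w: "w \<in> U" "w \<notin> E" by blast
    have "U = {scale c w + e | c e. e \<in> U \<inter> E}"
      using inter_line_extension[OF E(1) U w] relative_dim_Suc.prems by blast
    then obtain k where "n' = Suc k" "relative_dim scale I k (U \<inter> E)"
      using relative_dim_hyperplane[OF relative_dim_Suc.prems(1,2) E w] by blast
    then show ?thesis using relative_dim_Suc.IH[of k "U \<inter> E"] relative_dim_Suc.prems by auto
  qed
qed

lemma relative_dim_unique:
  assumes "relative_dim scale I n W" "relative_dim scale I n' W" "subspace I"
  shows "n = n'"
  using relative_dim_mono[OF assms(1,2,3)] relative_dim_mono[OF assms(2,1,3)] by simp

text \<open>Adding \<open>J\<close> to every member of the chain gives a chain over
  \<open>J\<close>, once the steps whose new vector already lies in the preceding sum are dropped;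
  so only the existence of a length is claimed.\<close>

lemma relative_dim_sum:
  assumes "relative_dim scale I n W" "subspace I" "subspace J" "I \<subseteq> J"
  shows "\<exists>n'. relative_dim scale J n' {x + y | x y. x \<in> W \<and> y \<in> J}"
  using assms
proof (induction rule: relative_dim.induct)
  case relative_dim_0
  have "{x + y | x y. x \<in> I \<and> y \<in> J} = J"
  proof
    show "J \<subseteq> {x + y | x y. x \<in> I \<and> y \<in> J}"
      using subspace_0[OF relative_dim_0(1)] by force
  qed (use relative_dim_0 in \<open>auto intro: subspace_add\<close>)
  then show ?case by (auto intro: relative_dim.intros)
next
  case (relative_dim_Suc n E v)
  define F where "F = {x + y | x y. x \<in> E \<and> y \<in> J}"
  obtain n' where n': "relative_dim scale J n' F"
    using relative_dim_Suc unfolding F_def by blast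
  have eq: "{x + y | x y. x \<in> {scale c v + e | c e. e \<in> E} \<and> y \<in> J} = {scale c v + e | c e. e \<in> F}"
  proof (intro equalityI subsetI)
    fix z assume "z \<in> {x + y | x y. x \<in> {scale c v + e | c e. e \<in> E} \<and> y \<in> J}"
    then obtain c e y where "z = scale c v + (e + y)" "e \<in> E" "y \<in> J" by (auto simp: add.assoc)
    then show "z \<in> {scale c v + e | c e. e \<in> F}" unfolding F_def by blast
  next
    fix z assume "z \<in> {scale c v + e | c e. e \<in> F}"
    then obtain c e y where "z = (scale c v + e) + y" "e \<in> E" "y \<in> J"
      unfolding F_def by (auto simp: add.assoc)
    then show "z \<in> {x + y | x y. x \<in> {scale c v + e | c e. e \<in> E} \<and> y \<in> J}" by blast
  qed
  show ?case
  proof (cases "v \<in> F")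
    case True
    have "subspace F" using n' relative_dim_Suc.prems relative_dim_subspace by blast
    then have "{scale c v + e | c e. e \<in> F} \<subseteq> F"
      using True by (auto intro!: subspace_add subspace_scale)
    then have "{scale c v + e | c e. e \<in> F} = F" using subset_line_extension[of F v] by blast
    then show ?thesis unfolding eq using n' by auto
  next
    case False
    then show ?thesis unfolding eq using relative_dim.relative_dim_Suc[OF n'] by blast
  qed
qed

text \<open>Serves twice: finite codimension passes from \<open>MJ\<close> up to \<open>J\<close>,
  and the syzygy space is seen to have finite codimension in the square of
  \<open>O2\<close>.\<close>

lemma relative_dim_larger_base:
  assumes "relative_dim scale I n W" "subspace I" "subspace J" "I \<subseteq> J" "J \<subseteq> W"
  shows "\<exists>n'. relative_dim scale J n' W"
proof -
  have W: "subspace W" using assms relative_dim_subspace by blast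
  have "{x + y | x y. x \<in> W \<and> y \<in> J} = W"
  proof
    show "{x + y | x y. x \<in> W \<and> y \<in> J} \<subseteq> W"
      using assms(5) subspace_add[OF W] by blast
    show "W \<subseteq> {x + y | x y. x \<in> W \<and> y \<in> J}"
    proof
      fix x assume "x \<in> W"
      moreover have "x = x + 0" by simp
      ultimately show "x \<in> {x + y | x y. x \<in> W \<and> y \<in> J}"
        using subspace_0[OF assms(3)] by blast
    qed
  qed
  then show ?thesis using relative_dim_sum[OF assms(1-4)] by simp
qed

end

text \<open>The last hypothesis says that \<open>\<psi>\<close> is injective from \<open>W\<close>
  modulo \<open>I\<close> to the target modulo \<open>T\<close>, so a new vector stays new. Forming
  the sum with \<open>T\<close> avoids quotient spaces.\<close>

lemma relative_dim_image:
  fixes \<psi> :: "'v::ab_group_add \<Rightarrow> 'w::ab_group_add"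
  assumes "Vector_Spaces.linear s1 s2 \<psi>" "relative_dim s1 I n W" "module.subspace s1 I" "module.subspace s2 T"
    and "\<And>x. x \<in> W \<Longrightarrow> \<psi> x \<in> T \<longleftrightarrow> x \<in> I"
  shows "relative_dim s2 T n {t + \<psi> x | t x. t \<in> T \<and> x \<in> W}"
proof -
  interpret Vector_Spaces.linear s1 s2 \<psi> by (rule assms(1))
  show ?thesis
    using assms(2-5)
  proof (induction rule: relative_dim.induct)
    case relative_dim_0
    have "{t + \<psi> x | t x. t \<in> T \<and> x \<in> I} = T"
    proof
      show "T \<subseteq> {t + \<psi> x | t x. t \<in> T \<and> x \<in> I}"
        using vs1.subspace_0[OF relative_dim_0(1)] zero by force
    qed (use relative_dim_0 in \<open>auto intro: vs2.subspace_add\<close>)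
    then show ?case by (auto intro: relative_dim.intros)
  next
    case (relative_dim_Suc n E v)
    let ?W = "{s1 c v + e | c e. e \<in> E}"
    have E: "vs1.subspace E" using relative_dim_Suc vs1.relative_dim_subspace by blast
    have EW: "E \<subseteq> ?W" by (rule vs1.subset_line_extension)
    have vW: "v \<in> ?W" by (rule vs1.mem_line_extension[OF E])
    have IE: "I \<subseteq> E" using relative_dim_Suc vs1.relative_dim_subset by blast
    let ?F = "{t + \<psi> x | t x. t \<in> T \<and> x \<in> E}"
    have "relative_dim s2 T n ?F" using relative_dim_Suc EW by blast
    moreover have "\<psi> v \<notin> ?F"
    proof
      assume "\<psi> v \<in> ?F"
      then obtain t x where t: "\<psi> v = t + \<psi> x" "t \<in> T" "x \<in> E" by blast
      have sW: "vs1.subspace ?W" by (rule vs1.subspace_line_extension[OF E])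
      have "\<psi> (v - x) \<in> T" using t diff by auto
      moreover have "v - x \<in> ?W" using vs1.subspace_diff[OF sW vW] t EW by blast
      ultimately have "v - x \<in> E" using relative_dim_Suc.prems(3) IE by blast
      then have "v - x + x \<in> E" using t E by (intro vs1.subspace_add)
      then show False using relative_dim_Suc by simp
    qed
    moreover have "{t + \<psi> x | t x. t \<in> T \<and> x \<in> ?W} = {s2 c (\<psi> v) + e | c e. e \<in> ?F}"
    proof -
      have *: "t + \<psi> (s1 c v + e) = s2 c (\<psi> v) + (t + \<psi> e)" for t c e
        by (simp add: add scale add_ac)
      show ?thesis
      proof (intro equalityI subsetI)
        fix z assume "z \<in> {t + \<psi> x | t x. t \<in> T \<and> x \<in> ?W}"
        then show "z \<in> {s2 c (\<psi> v) + e | c e. e \<in> ?F}" using * by blast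
      next
        fix z assume "z \<in> {s2 c (\<psi> v) + e | c e. e \<in> ?F}"
        then show "z \<in> {t + \<psi> x | t x. t \<in> T \<and> x \<in> ?W}" using *[symmetric] by blast
      qed
    qed
    ultimately show ?case
      using relative_dim.relative_dim_Suc[of s2 T n ?F "\<psi> v"] by simp
  qed
qed

section \<open>Dimension of quotients by ideals\<close>

definition scale2 :: "complex \<Rightarrow> complex fps fps \<Rightarrow> complex fps fps" where
  "scale2 c f = const2 c * f"

lemma const2_add: "const2 (a + b) = const2 a + const2 b"
  by (simp add: const2_def)

lemma const2_mult: "const2 (a * b) = const2 a * const2 b"
  by (simp add: const2_def)

lemma coeff2_scale2 [simp]: "coeff2 (scale2 c f) i j = c * coeff2 f i j"
  by (simp add: scale2_def const2_def coeff2_def)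

interpretation series: vector_space scale2
  by unfold_locales (simp_all add: scale2_def const2_add const2_mult const2_1 algebra_simps)

interpretation O2: cring O2
  by (rule cring_O2)

lemma subspace_ideal:
  assumes "ideal I O2" shows "series.subspace I"
proof -
  interpret I: ideal I O2 by (rule assms)
  show ?thesis
    using I.zero_closed I.a_closed I.I_l_closed
    by (intro series.subspaceI) (auto simp: scale2_def convergent2_const2)
qed

lemma subspace_carrier: "series.subspace (carrier O2)"
  by (rule subspace_ideal[OF O2.oneideal])

section \<open>Quotient rings of \<open>O2\<close> and chains of subspaces above an ideal\<close>

context
  fixes I :: "complex fps fps set"
  assumes ideal: "ideal I O2"
begin

interpretation I: ideal I O2 by (rule ideal)

lemma coset_eq_iff:
  assumes "f \<in> carrier O2" "g \<in> carrier O2"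
  shows "I +>\<^bsub>O2\<^esub> f = I +>\<^bsub>O2\<^esub> g \<longleftrightarrow> f - g \<in> I"
proof -
  have "\<ominus>\<^bsub>O2\<^esub> g = - g"
    using assms by (intro O2.minus_equality) (auto simp: convergent2_uminus)
  then have "f \<ominus>\<^bsub>O2\<^esub> g = f - g" by (simp add: a_minus_def)
  then show ?thesis
    using O2.quotient_eq_iff_same_a_r_cos[OF ideal assms] by metis
qed

lemma carrier_quotient: "carrier (O2 Quot I) = (+>\<^bsub>O2\<^esub>) I ` carrier O2"
  unfolding FactRing_def A_RCOSETS_def' by auto

lemma image_ideal_quotient: "(+>\<^bsub>O2\<^esub>) I ` I = {\<zero>\<^bsub>O2 Quot I\<^esub>}"
proof -
  have "I +>\<^bsub>O2\<^esub> f = I" if "f \<in> I" for f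
  proof -
    have "I +>\<^bsub>O2\<^esub> f = I +>\<^bsub>O2\<^esub> 0"
      using that I.Icarr O2.zero_closed by (subst coset_eq_iff) auto
    also have "\<dots> = I" by (simp add: a_r_coset_def')
    finally show ?thesis .
  qed
  then show ?thesis using I.zero_closed by (auto simp: FactRing_def)
qed

lemma line_extension_quotient:
  assumes "v \<in> carrier O2" "E \<subseteq> carrier O2"
  shows "ring.line_extension (O2 Quot I) (range (\<lambda>c. I +>\<^bsub>O2\<^esub> const2 c)) (I +>\<^bsub>O2\<^esub> v)
      ((+>\<^bsub>O2\<^esub>) I ` E) = (+>\<^bsub>O2\<^esub>) I ` {scale2 c v + e | c e. e \<in> E}"
proof -
  have "(I +>\<^bsub>O2\<^esub> const2 c) \<otimes>\<^bsub>O2 Quot I\<^esub> (I +>\<^bsub>O2\<^esub> v) \<oplus>\<^bsub>O2 Quot I\<^esub> (I +>\<^bsub>O2\<^esub> e)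
      = I +>\<^bsub>O2\<^esub> (scale2 c v + e)" if "e \<in> E" for c e
  proof -
    have "const2 c \<in> carrier O2" "e \<in> carrier O2"
      using that assms by (auto simp: convergent2_const2)
    then show ?thesis
      using assms(1) ring_hom_mult[OF I.rcos_ring_hom, of "const2 c" v]
        ring_hom_add[OF I.rcos_ring_hom, of "scale2 c v" e]
      by (simp add: scale2_def convergent2_mult)
  qed
  then have "(\<Union>c. \<Union>e\<in>E. {(I +>\<^bsub>O2\<^esub> const2 c) \<otimes>\<^bsub>O2 Quot I\<^esub> (I +>\<^bsub>O2\<^esub> v)
      \<oplus>\<^bsub>O2 Quot I\<^esub> (I +>\<^bsub>O2\<^esub> e)}) = (\<Union>c. \<Union>e\<in>E. {I +>\<^bsub>O2\<^esub> (scale2 c v + e)})"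
    by simp
  also have "\<dots> = (+>\<^bsub>O2\<^esub>) I ` {scale2 c v + e | c e. e \<in> E}"
    by blast
  finally show ?thesis
    unfolding ring.line_extension_def[OF I.quotient_is_ring] r_coset_def set_add_def' by simp
qed

text \<open>Taking cosets turns a chain above \<open>I\<close> into a chain in the quotient; a new
  vector stays new because every member of the chain contains \<open>I\<close>.\<close>

lemma dimension_quotientI:
  assumes "relative_dim scale2 I n W" "W \<subseteq> carrier O2"
  shows "ring.dimension (O2 Quot I) n (range (\<lambda>c. I +>\<^bsub>O2\<^esub> const2 c)) ((+>\<^bsub>O2\<^esub>) I ` W)"
  using assms
proof (induction rule: relative_dim.induct)
  case relative_dim_0
  then show ?case
    by (simp add: image_ideal_quotient ring.zero_dim[OF I.quotient_is_ring])
next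
  case (relative_dim_Suc n E v)
  have sE: "series.subspace E"
    by (rule series.relative_dim_subspace[OF relative_dim_Suc.hyps(1) subspace_ideal[OF ideal]])
  have E: "E \<subseteq> carrier O2" and v: "v \<in> carrier O2"
    using relative_dim_Suc.prems series.subset_line_extension[of E v] series.mem_line_extension[OF sE, of v]
    by blast+
  have "I +>\<^bsub>O2\<^esub> v \<notin> (+>\<^bsub>O2\<^esub>) I ` E"
  proof
    assume "I +>\<^bsub>O2\<^esub> v \<in> (+>\<^bsub>O2\<^esub>) I ` E"
    then obtain e where e: "e \<in> E" "v - e \<in> I" using coset_eq_iff v E by blast
    then have "v - e + e \<in> E"
      using series.relative_dim_subset[OF relative_dim_Suc.hyps(1)] sE by (blast intro: series.subspace_add)
    then show False using relative_dim_Suc.hyps by simp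
  qed
  moreover have "I +>\<^bsub>O2\<^esub> v \<in> carrier (O2 Quot I)"
    using ring_hom_closed[OF I.rcos_ring_hom] v by blast
  ultimately show ?case
    unfolding line_extension_quotient[OF v E, symmetric]
    using relative_dim_Suc.IH[OF E] ring.Suc_dim[OF I.quotient_is_ring] by blast
qed

lemma dimension_quotientD:
  assumes "ring.dimension (O2 Quot I) n (range (\<lambda>c. I +>\<^bsub>O2\<^esub> const2 c)) A"
  shows "\<exists>W. relative_dim scale2 I n W \<and> W \<subseteq> carrier O2 \<and> A = (+>\<^bsub>O2\<^esub>) I ` W"
  using assms
proof (induction n "range (\<lambda>c. I +>\<^bsub>O2\<^esub> const2 c)" A rule: ring.dimension.induct[OF I.quotient_is_ring, consumes 1])
  case 1
  then show ?case
    using I.a_subset image_ideal_quotient by (intro exI[of _ I]) (auto intro: relative_dim.intros)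
next
  case (2 v A n)
  then obtain E where E: "relative_dim scale2 I n E" "E \<subseteq> carrier O2" "A = (+>\<^bsub>O2\<^esub>) I ` E"
    by blast
  obtain w where w: "w \<in> carrier O2" "v = I +>\<^bsub>O2\<^esub> w"
    using 2 carrier_quotient by blast
  have "w \<notin> E" using 2 w E by blast
  then have "relative_dim scale2 I (Suc n) {scale2 c w + e | c e. e \<in> E}"
    using E by (intro relative_dim.intros)
  moreover have "{scale2 c w + e | c e. e \<in> E} \<subseteq> carrier O2"
    using w E(2) by (auto simp: scale2_def intro!: convergent2_add convergent2_mult convergent2_const2)
  ultimately show ?case
    unfolding w(2) E(3) line_extension_quotient[OF w(1) E(2)] by blast
qed

lemma dimension_quotient_iff:
  "ring.dimension (O2 Quot I) n (range (\<lambda>c. I +>\<^bsub>O2\<^esub> const2 c)) (carrier (O2 Quot I))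
    \<longleftrightarrow> relative_dim scale2 I n (carrier O2)"
proof -
  \<comment> \<open>A lifted chain ends in some \<open>W\<close> with the same cosets as the whole
    ring; since \<open>W\<close> contains \<open>I\<close>, it is the whole ring.\<close>
  have "W = carrier O2"
    if W: "relative_dim scale2 I n W" "W \<subseteq> carrier O2" "(+>\<^bsub>O2\<^esub>) I ` carrier O2 = (+>\<^bsub>O2\<^esub>) I ` W" for W
  proof
    show "carrier O2 \<subseteq> W"
    proof
      fix f assume f: "f \<in> carrier O2"
      then have "I +>\<^bsub>O2\<^esub> f \<in> (+>\<^bsub>O2\<^esub>) I ` W" unfolding W(3)[symmetric] by (rule imageI)
      then obtain g where g: "g \<in> W" "I +>\<^bsub>O2\<^esub> f = I +>\<^bsub>O2\<^esub> g" by (rule imageE)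
      then have "f - g \<in> W"
        using coset_eq_iff[OF f, of g] W(2) series.relative_dim_subset[OF W(1)] by blast
      then have "f - g + g \<in> W"
        using g(1) series.relative_dim_subspace[OF W(1) subspace_ideal[OF ideal]]
        by (intro series.subspace_add)
      then show "f \<in> W" by simp
    qed
  qed (rule W)
  then show ?thesis
    unfolding carrier_quotient using dimension_quotientI[of n "carrier O2"] dimension_quotientD[of n] by (metis order_refl)
qed

lemma quot_dim_eq:
  assumes "relative_dim scale2 I n (carrier O2)"
  shows "quot_dim I = enat n"
proof -
  \<comment> \<open>\<open>ring.dim\<close> is a definite description, so uniqueness of the
    codimension is required here.\<close>
  have "(THE n'. relative_dim scale2 I n' (carrier O2)) = n"
    by (rule the_equality, rule assms, rule series.relative_dim_unique[OF _ assms subspace_ideal[OF ideal]])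
  moreover have "\<exists>n. relative_dim scale2 I n (carrier O2)" using assms by (rule exI)
  ultimately show ?thesis
    unfolding quot_dim_def Let_def ring.finite_dimension_def[OF I.quotient_is_ring]
      ring.dim_def[OF I.quotient_is_ring] dimension_quotient_iff by simp
qed

lemma quot_dim_eq_infinity:
  assumes "\<nexists>n. relative_dim scale2 I n (carrier O2)"
  shows "quot_dim I = \<infinity>"
  using assms
  unfolding quot_dim_def Let_def ring.finite_dimension_def[OF I.quotient_is_ring] dimension_quotient_iff
  by simp

end

section \<open>Powers of the maximal ideal\<close>

lemma coeff2_diff [simp]: "coeff2 (f - g) i j = coeff2 f i j - coeff2 g i j"
  by (simp add: coeff2_def)

lemma coeff2_eqI: "(\<And>i j. coeff2 f i j = coeff2 g i j) \<Longrightarrow> f = g"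
  by (simp add: coeff2_def fps_eq_iff)

lemma coeff2_Abs [simp]: "coeff2 (Abs_fps (\<lambda>i. Abs_fps (c i))) i j = c i j"
  by (simp add: coeff2_def)

lemma convergent2_diff: "convergent2 f \<Longrightarrow> convergent2 g \<Longrightarrow> convergent2 (f - g)"
  using convergent2_add[of f "- g"] convergent2_uminus by simp

lemma convergent2_scale2: "convergent2 f \<Longrightarrow> convergent2 (scale2 c f)"
  by (simp add: scale2_def convergent2_mult convergent2_const2)

lemma convergent2_coeff_le:
  assumes "convergent2 f" "\<And>i j. norm (coeff2 g i j) \<le> norm (coeff2 f i j)"
  shows "convergent2 g"
proof -
  obtain C R where "C \<ge> 0" "R \<ge> 1" "\<And>i j. norm (coeff2 f i j) \<le> C * R ^ (i + j)"
    using convergent2E[OF assms(1)] by blast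
  then show ?thesis
    using order_trans[OF assms(2)] by (intro convergent2I[of R g C]) auto
qed

lemma convergent2_shift:
  assumes "convergent2 f" "\<And>i j. coeff2 g i j = coeff2 f (i + a) (j + b)"
  shows "convergent2 g"
proof -
  obtain C R where 1: "C \<ge> 0" "R \<ge> 1" "\<And>i j. norm (coeff2 f i j) \<le> C * R ^ (i + j)"
    using convergent2E[OF assms(1)] by blast
  show ?thesis
  proof (rule convergent2I[of R])
    fix i j
    show "norm (coeff2 g i j) \<le> (C * R ^ (a + b)) * R ^ (i + j)"
      using 1(3)[of "i + a" "j + b"] by (simp add: assms(2) power_add mult_ac)
  qed (use 1 in auto)
qed

definition monom2 :: "nat \<Rightarrow> nat \<Rightarrow> complex fps fps" where
  "monom2 a b = fps_X ^ a * fps_const (fps_X ^ b)"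

lemma coeff2_monom2 [simp]: "coeff2 (monom2 a b) i j = (if i = a \<and> j = b then 1 else 0)"
  by (simp add: coeff2_def monom2_def fps_X_power_mult_nth fps_X_power_nth)

lemma coeff2_monom2_mult:
  "coeff2 (monom2 a b * f) i j = (if a \<le> i \<and> b \<le> j then coeff2 f (i - a) (j - b) else 0)"
  by (simp add: coeff2_def monom2_def fps_X_power_mult_nth mult.assoc)

lemma convergent2_monom2: "convergent2 (monom2 a b)"
  by (rule convergent2I[of 1 _ 1]) auto

text \<open>An arbitrary exponent set covers both the powers of the maximal ideal, where it is a
  triangle, and the series in one variable, where it is the complement of an axis.\<close>

definition vanishing_on :: "(nat \<times> nat) set \<Rightarrow> complex fps fps set" where
  "vanishing_on A = {f. convergent2 f \<and> (\<forall>i j. (i, j) \<in> A \<longrightarrow> coeff2 f i j = 0)}"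

lemma subspace_vanishing_on: "series.subspace (vanishing_on A)"
  by (rule series.subspaceI)
    (auto simp: vanishing_on_def convergent2_add convergent2_scale2 O2.zero_closed[simplified])

lemma vanishing_on_empty: "vanishing_on {} = carrier O2"
  by (auto simp: vanishing_on_def)

lemma vanishing_on_UNIV: "vanishing_on UNIV = {0}"
  using O2.zero_closed by (auto simp: vanishing_on_def intro: coeff2_eqI)

text \<open>The monomials with exponents in \<open>B\<close>, adjoined one at a time, form the
  chain; the coordinate along each is the coefficient at its exponent.\<close>

lemma relative_dim_vanishing_on:
  assumes "finite B" "A \<inter> B = {}"
  shows "relative_dim scale2 (vanishing_on (A \<union> B)) (card B) (vanishing_on A)"
  using assms
proof (induction B rule: finite_induct)
  case empty
  then show ?case by (simp add: relative_dim.intros)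
next
  case (insert p B)
  obtain a b where p: "p = (a, b)" by (cases p)
  let ?U = "vanishing_on (A \<union> insert p B)"
  have eq: "vanishing_on (A \<union> B) = {scale2 c (monom2 a b) + e | c e. e \<in> ?U}"
  proof (intro equalityI subsetI)
    fix f assume f: "f \<in> vanishing_on (A \<union> B)"
    have "f - scale2 (coeff2 f a b) (monom2 a b) \<in> ?U"
      using f insert by (auto simp: vanishing_on_def p
          intro!: convergent2_diff convergent2_scale2 convergent2_monom2)
    moreover have "f = scale2 (coeff2 f a b) (monom2 a b) + (f - scale2 (coeff2 f a b) (monom2 a b))"
      by simp
    ultimately show "f \<in> {scale2 c (monom2 a b) + e | c e. e \<in> ?U}" by blast
  next
    fix f assume "f \<in> {scale2 c (monom2 a b) + e | c e. e \<in> ?U}"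
    then show "f \<in> vanishing_on (A \<union> B)"
      using insert by (auto simp: vanishing_on_def p
          intro!: convergent2_add convergent2_scale2 convergent2_monom2)
  qed
  have "relative_dim scale2 ?U (Suc 0) (vanishing_on (A \<union> B))"
    unfolding eq by (intro relative_dim.intros) (auto simp: vanishing_on_def p)
  from relative_dim_trans[OF _ this, of "card B" "vanishing_on A"]
  show ?case using insert by auto
qed

text \<open>This is the \<open>k\<close>-th power of the maximal ideal, described by the order of
  vanishing; \<open>max_ideal_power\<close> proves the agreement.\<close>

definition order_ideal :: "nat \<Rightarrow> complex fps fps set" where
  "order_ideal k = vanishing_on {(i, j). i + j < k}"

lemma mem_order_ideal:
  "f \<in> order_ideal k \<longleftrightarrow> convergent2 f \<and> (\<forall>i j. i + j < k \<longrightarrow> coeff2 f i j = 0)"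
  by (auto simp: order_ideal_def vanishing_on_def)

lemma order_ideal_0: "order_ideal 0 = carrier O2"
  by (simp add: order_ideal_def vanishing_on_empty)

lemma finite_triangle: "finite {(i, j). i + j < (k::nat)}"
  by (rule finite_subset[of _ "{..<k} \<times> {..<k}"]) auto

lemma card_triangle: "card {(i, j). i + j < (k::nat)} = k * (k + 1) div 2"
proof (induction k)
  case (Suc k)
  have eq: "{(i, j). i + j < Suc k} = {(i, j). i + j < k} \<union> (\<lambda>i. (i, k - i)) ` {..k}"
    by (auto simp: image_iff less_Suc_eq)
  have "card {(i, j). i + j < Suc k} = card {(i, j). i + j < k} + card ((\<lambda>i. (i, k - i)) ` {..k})"
    unfolding eq by (rule card_Un_disjoint) (auto simp: finite_triangle)
  also have "card ((\<lambda>i. (i, k - i)) ` {..k}) = k + 1"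
    by (subst card_image) (auto simp: inj_on_def)
  finally show ?case using Suc by simp
qed auto

lemma relative_dim_order_ideal:
  "relative_dim scale2 (order_ideal k) (k * (k + 1) div 2) (carrier O2)"
  using relative_dim_vanishing_on[OF finite_triangle[of k], of "{}"]
  by (simp add: order_ideal_def vanishing_on_empty card_triangle)

lemma coeff2_mult_eq_0:
  assumes "\<And>i j. i + j < k \<Longrightarrow> coeff2 f i j = 0" "\<And>i j. i + j < l \<Longrightarrow> coeff2 g i j = 0" "i + j < k + l"
  shows "coeff2 (f * g) i j = 0"
  unfolding coeff2_mult
proof (intro sum.neutral ballI)
  fix a b assume ab: "a \<in> {0..i}" "b \<in> {0..j}"
  have "a + b < k \<or> (i - a) + (j - b) < l" using ab assms(3) by auto
  then show "coeff2 f a b * coeff2 g (i - a) (j - b) = 0" using assms(1,2) by auto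
qed

lemma order_ideal_mult:
  "f \<in> order_ideal k \<Longrightarrow> g \<in> order_ideal l \<Longrightarrow> f * g \<in> order_ideal (k + l)"
  using coeff2_mult_eq_0[of k f l g] by (auto simp: mem_order_ideal convergent2_mult)

text \<open>Among the monomials of lowest degree, the one with the least exponent of \<open>x\<close> survives in a product.\<close>

lemma lowest_coeff2E:
  assumes "coeff2 f a b \<noteq> 0" "\<And>i j. i + j < a + b \<Longrightarrow> coeff2 f i j = 0"
  obtains a' b' where "a' + b' = a + b" "coeff2 f a' b' \<noteq> 0"
    "\<And>i j. i + j < a + b \<or> (i + j = a + b \<and> i < a') \<Longrightarrow> coeff2 f i j = 0"
proof -
  let ?P = "\<lambda>i. i \<le> a + b \<and> coeff2 f i (a + b - i) \<noteq> 0"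
  define l where "l = (LEAST i. ?P i)"
  have l: "?P l" unfolding l_def by (rule LeastI[of ?P a]) (use assms in auto)
  have "coeff2 f i j = 0" if "i + j < a + b \<or> (i + j = a + b \<and> i < l)" for i j
  proof (cases "i + j < a + b")
    case False
    then have ij: "i + j = a + b" and P: "\<not> ?P i"
      using that not_less_Least[of i ?P] unfolding l_def by blast+
    have "j = a + b - i" "i \<le> a + b" using ij by simp_all
    then show ?thesis using P by blast
  qed (use assms in auto)
  then show ?thesis using l by (intro that[of l "a + b - l"]) simp_all
qed

lemma coeff2_mult_lowest:
  assumes f: "coeff2 f a b \<noteq> 0" "\<And>i j. i + j < a + b \<Longrightarrow> coeff2 f i j = 0"
    and g: "coeff2 g c d \<noteq> 0" "\<And>i j. i + j < c + d \<Longrightarrow> coeff2 g i j = 0"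
  shows "\<exists>i j. i + j = (a + b) + (c + d) \<and> coeff2 (f * g) i j \<noteq> 0"
proof -
  obtain a' b' where f': "a' + b' = a + b" "coeff2 f a' b' \<noteq> 0"
    "\<And>i j. i + j < a + b \<or> (i + j = a + b \<and> i < a') \<Longrightarrow> coeff2 f i j = 0"
    using lowest_coeff2E[OF f] by blast
  obtain c' d' where g': "c' + d' = c + d" "coeff2 g c' d' \<noteq> 0"
    "\<And>i j. i + j < c + d \<or> (i + j = c + d \<and> i < c') \<Longrightarrow> coeff2 g i j = 0"
    using lowest_coeff2E[OF g] by blast
  have "coeff2 (f * g) (a' + c') (b' + d')
      = (\<Sum>(i, j)\<in>{0..a' + c'} \<times> {0..b' + d'}. coeff2 f i j * coeff2 g (a' + c' - i) (b' + d' - j))"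
    unfolding coeff2_mult by (simp add: sum.cartesian_product)
  also have "\<dots> = (\<Sum>(i, j)\<in>{(a', b')}. coeff2 f i j * coeff2 g (a' + c' - i) (b' + d' - j))"
  proof (rule sum.mono_neutral_right)
    show "\<forall>p\<in>{0..a' + c'} \<times> {0..b' + d'} - {(a', b')}.
        (case p of (i, j) \<Rightarrow> coeff2 f i j * coeff2 g (a' + c' - i) (b' + d' - j)) = 0"
    proof (rule ballI, unfold split_paired_all prod.case)
      fix i j assume "(i, j) \<in> {0..a' + c'} \<times> {0..b' + d'} - {(a', b')}"
      then have ij: "i \<in> {0..a' + c'}" "j \<in> {0..b' + d'}" "(i, j) \<noteq> (a', b')" by auto
      \<comment> \<open>Exponents are ordered by degree, then by the exponent of \<open>x\<close>.
        In the first two cases \<open>(i, j)\<close> precedes \<open>(a', b')\<close> and the factor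
        from \<open>f\<close> vanishes; in the last two the complementary exponent precedes
        \<open>(c', d')\<close> and the factor from \<open>g\<close> vanishes.\<close>
      from ij(3) consider "i + j < a + b" | "i + j = a + b" "i < a'" | "i + j = a + b" "i > a'" | "i + j > a + b"
        using f'(1) by fastforce
      then show "coeff2 f i j * coeff2 g (a' + c' - i) (b' + d' - j) = 0"
      proof cases
        case 3
        then have "coeff2 g (a' + c' - i) (b' + d' - j) = 0"
          using ij f'(1) g'(1) by (intro g'(3)) auto
        then show ?thesis by simp
      next
        case 4
        then have "coeff2 g (a' + c' - i) (b' + d' - j) = 0"
          using ij f'(1) g'(1) by (intro g'(3)) auto
        then show ?thesis by simp
      qed (use f'(3) in auto)
    qed
  qed auto
  also have "\<dots> \<noteq> 0" using f' g' by simp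
  finally have "coeff2 (f * g) (a' + c') (b' + d') \<noteq> 0" .
  moreover have "(a' + c') + (b' + d') = (a + b) + (c + d)" using f'(1) g'(1) by simp
  ultimately show ?thesis by blast
qed

lemma nonzero_coeff2E:
  assumes "f \<noteq> 0"
  obtains a b where "coeff2 f a b \<noteq> 0" "\<And>i j. i + j < a + b \<Longrightarrow> coeff2 f i j = 0"
proof -
  let ?P = "\<lambda>n. \<exists>i j. i + j = n \<and> coeff2 f i j \<noteq> 0"
  define l where "l = (LEAST n. ?P n)"
  have "\<exists>n. ?P n" using assms coeff2_eqI[of f 0] by auto
  then have "?P l" unfolding l_def by (rule LeastI_ex)
  then obtain a b where ab: "a + b = l" "coeff2 f a b \<noteq> 0" by blast
  have "coeff2 f i j = 0" if "i + j < l" for i j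
    using not_less_Least[of "i + j" ?P] that unfolding l_def by blast
  then show ?thesis using ab by (intro that[of a b]) simp_all
qed

text \<open>Orders of vanishing add, since the product of the lowest terms survives. For
  \<open>k\<close> at most the order of \<open>a\<close>, the difference truncates to 0 and the
  right side is the whole ring, as it should be.\<close>

lemma mult_mem_order_ideal_iff:
  assumes a: "convergent2 a" "coeff2 a i0 j0 \<noteq> 0" "\<And>i j. i + j < i0 + j0 \<Longrightarrow> coeff2 a i j = 0"
    and q: "convergent2 q"
  shows "q * a \<in> order_ideal k \<longleftrightarrow> q \<in> order_ideal (k - (i0 + j0))"
proof
  assume qa: "q * a \<in> order_ideal k"
  show "q \<in> order_ideal (k - (i0 + j0))"
  proof (cases "q = 0")
    case False
    then obtain c d where cd: "coeff2 q c d \<noteq> 0" "\<And>i j. i + j < c + d \<Longrightarrow> coeff2 q i j = 0"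
      using nonzero_coeff2E by blast
    obtain i j where "i + j = (c + d) + (i0 + j0)" "coeff2 (q * a) i j \<noteq> 0"
      using coeff2_mult_lowest[OF cd a(2,3)] by blast
    then have "k \<le> (c + d) + (i0 + j0)" using qa by (auto simp: mem_order_ideal not_less[symmetric])
    then show ?thesis using cd(2) q by (auto simp: mem_order_ideal)
  qed (use q in \<open>auto simp: mem_order_ideal\<close>)
next
  assume "q \<in> order_ideal (k - (i0 + j0))"
  \<comment> \<open>Under truncated subtraction this exponent is the maximum of \<open>k\<close> and
    \<open>i0 + j0\<close>, hence at least \<open>k\<close>.\<close>
  then have "q * a \<in> order_ideal ((k - (i0 + j0)) + (i0 + j0))"
    using a by (intro order_ideal_mult) (auto simp: mem_order_ideal)
  then show "q * a \<in> order_ideal k" by (auto simp: mem_order_ideal)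
qed

section \<open>Order ideals as powers of the maximal ideal\<close>

lemma max_ideal_eq: "max_ideal = order_ideal 1"
  by (auto simp: max_ideal_def mem_order_ideal)

lemma ideal_max_ideal: "ideal max_ideal O2"
  using maximalideal_max_ideal by (rule maximalideal.axioms)

text \<open>Monomials containing \<open>x\<close> go to \<open>g\<close>, the remaining pure powers
  of \<open>y\<close> to \<open>h\<close>; dividing by one variable lowers the order by one.\<close>

lemma order_ideal_Suc_decomp:
  assumes "f \<in> order_ideal (Suc k)"
  obtains g h where "g \<in> order_ideal k" "h \<in> order_ideal k" "f = g * monom2 1 0 + h * monom2 0 1"
proof -
  define g where "g = Abs_fps (\<lambda>i. Abs_fps (\<lambda>j. coeff2 f (i + 1) j))"
  \<comment> \<open>This plain shift of \<open>f\<close> dominates \<open>h\<close> coefficientwise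
    and thereby makes \<open>h\<close> convergent.\<close>
  define h' where "h' = Abs_fps (\<lambda>i. Abs_fps (\<lambda>j. coeff2 f i (j + 1)))"
  define h where "h = Abs_fps (\<lambda>i. Abs_fps (\<lambda>j. if i = 0 then coeff2 f i (j + 1) else 0))"
  have f: "convergent2 f" "\<And>i j. i + j < Suc k \<Longrightarrow> coeff2 f i j = 0"
    using assms by (auto simp: mem_order_ideal)
  have "convergent2 g" by (rule convergent2_shift[OF f(1), of _ 1 0]) (simp add: g_def)
  moreover have "convergent2 h'" by (rule convergent2_shift[OF f(1), of _ 0 1]) (simp add: h'_def)
  then have "convergent2 h" by (rule convergent2_coeff_le) (simp add: h'_def h_def)
  ultimately have "g \<in> order_ideal k" "h \<in> order_ideal k"
    using f(2) by (auto simp: mem_order_ideal g_def h_def)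
  moreover have "f = g * monom2 1 0 + h * monom2 0 1"
  proof (rule coeff2_eqI)
    fix i j
    have "coeff2 f 0 0 = 0" using f(2) by simp
    then show "coeff2 f i j = coeff2 (g * monom2 1 0 + h * monom2 0 1) i j"
      unfolding mult.commute[of g] mult.commute[of h]
      by (cases i; cases j) (auto simp: coeff2_monom2_mult g_def h_def)
  qed
  ultimately show ?thesis using that by blast
qed

lemma max_ideal_power: "max_ideal [^]\<^bsub>ideals_set O2\<^esub> k = order_ideal k"
proof (induction k)
  case 0
  then show ?case by (simp add: ideals_set_def order_ideal_0)
next
  case (Suc k)
  have "order_ideal k \<cdot>\<^bsub>O2\<^esub> max_ideal = order_ideal (Suc k)"
  proof (intro equalityI subsetI)
    fix f assume "f \<in> order_ideal k \<cdot>\<^bsub>O2\<^esub> max_ideal"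
    then show "f \<in> order_ideal (Suc k)"
    proof induction
      case (prod g h)
      then show ?case using order_ideal_mult[of g k h 1] by (simp add: max_ideal_eq)
    next
      case (sum g h)
      then show ?case by (auto simp: mem_order_ideal convergent2_add)
    qed
  next
    fix f assume "f \<in> order_ideal (Suc k)"
    then obtain g h where gh: "g \<in> order_ideal k" "h \<in> order_ideal k" "f = g * monom2 1 0 + h * monom2 0 1"
      by (rule order_ideal_Suc_decomp)
    have "monom2 1 0 \<in> max_ideal" "monom2 0 1 \<in> max_ideal"
      by (auto simp: max_ideal_def convergent2_monom2)
    then show "f \<in> order_ideal k \<cdot>\<^bsub>O2\<^esub> max_ideal"
      using ideal_prod.sum[OF ideal_prod.prod ideal_prod.prod, of g _ _ max_ideal h _ O2] gh by auto
  qed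
  then show ?case using Suc by (simp add: ideals_set_def)
qed

section \<open>Ideals with two generators\<close>

lemma genideal_pair:
  assumes "a \<in> carrier O2" "b \<in> carrier O2"
  shows "Idl\<^bsub>O2\<^esub> {a, b} = {g * a + h * b | g h. g \<in> carrier O2 \<and> h \<in> carrier O2}"
    (is "_ = ?J")
proof
  have "ideal ?J O2"
  proof (rule idealI[OF O2.ring_axioms])
    show "subgroup ?J (add_monoid O2)"
    proof (rule O2.add.subgroupI)
      show "?J \<subseteq> carrier O2" using assms by (auto intro!: convergent2_add convergent2_mult)
      show "?J \<noteq> {}" using assms by auto
    next
      fix x assume "x \<in> ?J"
      then obtain g h where gh: "x = g * a + h * b" "convergent2 g" "convergent2 h" by auto
      then have "convergent2 x" using assms by (auto intro!: convergent2_add convergent2_mult)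
      then have "\<ominus>\<^bsub>O2\<^esub> x = - x"
        by (intro O2.minus_equality) (auto simp: convergent2_uminus)
      also have "\<dots> = (- g) * a + (- h) * b" using gh by simp
      finally have "\<ominus>\<^bsub>O2\<^esub> x = (- g) * a + (- h) * b" .
      moreover have "- g \<in> carrier O2" "- h \<in> carrier O2" using gh by (simp_all add: convergent2_uminus)
      ultimately show "\<ominus>\<^bsub>O2\<^esub> x \<in> ?J" by blast
    next
      fix x y assume "x \<in> ?J" "y \<in> ?J"
      then obtain g h g' h' where "x = g * a + h * b" "y = g' * a + h' * b"
        "convergent2 g" "convergent2 h" "convergent2 g'" "convergent2 h'" by auto
      then have "x + y = (g + g') * a + (h + h') * b" "convergent2 (g + g')" "convergent2 (h + h')"
        by (auto simp: algebra_simps intro: convergent2_add)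
      then show "x \<oplus>\<^bsub>O2\<^esub> y \<in> ?J" by auto
    qed
  next
    fix x y assume "x \<in> ?J" and y: "y \<in> carrier O2"
    then obtain g h where "x = g * a + h * b" "convergent2 g" "convergent2 h" by auto
    then have "y * x = (y * g) * a + (y * h) * b" "convergent2 (y * g)" "convergent2 (y * h)"
      using y by (auto simp: algebra_simps intro: convergent2_mult)
    then have yx: "y * x \<in> ?J" by auto
    then show "y \<otimes>\<^bsub>O2\<^esub> x \<in> ?J" by simp
    show "x \<otimes>\<^bsub>O2\<^esub> y \<in> ?J" using yx by (simp add: mult.commute)
  qed
  moreover have "a = 1 * a + 0 * b" "b = 0 * a + 1 * b" by simp_all
  then have "a \<in> ?J" "b \<in> ?J"
    using O2.zero_closed O2.one_closed unfolding O2_simps by blast+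
  ultimately show "Idl\<^bsub>O2\<^esub> {a, b} \<subseteq> ?J" by (intro O2.genideal_minimal) auto
next
  interpret J: ideal "Idl\<^bsub>O2\<^esub> {a, b}" O2 by (rule O2.genideal_ideal) (use assms in auto)
  have "a \<in> Idl\<^bsub>O2\<^esub> {a, b}" "b \<in> Idl\<^bsub>O2\<^esub> {a, b}"
    using O2.genideal_self[of "{a, b}"] assms by auto
  then show "?J \<subseteq> Idl\<^bsub>O2\<^esub> {a, b}"
    using J.I_l_closed J.a_closed by auto
qed

text \<open>In a product \<open>g * (u * a + v * b)\<close> the factors \<open>u\<close> and
  \<open>v\<close> are absorbed into \<open>g\<close>, so finite sums of such products still need
  only two coefficients of order at least \<open>k\<close>.\<close>

lemma order_ideal_prod_genideal_pair:
  assumes "a \<in> carrier O2" "b \<in> carrier O2"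
  shows "order_ideal k \<cdot>\<^bsub>O2\<^esub> (Idl\<^bsub>O2\<^esub> {a, b})
    = {g * a + h * b | g h. g \<in> order_ideal k \<and> h \<in> order_ideal k}" (is "_ = ?MJ")
proof (intro equalityI subsetI)
  fix f assume "f \<in> order_ideal k \<cdot>\<^bsub>O2\<^esub> (Idl\<^bsub>O2\<^esub> {a, b})"
  then show "f \<in> ?MJ"
  proof induction
    case (prod g f)
    then obtain u v where uv: "f = u * a + v * b" "convergent2 u" "convergent2 v"
      unfolding genideal_pair[OF assms] by auto
    have "u \<in> order_ideal 0" "v \<in> order_ideal 0" using uv by (simp_all add: order_ideal_0)
    then have "g * u \<in> order_ideal k" "g * v \<in> order_ideal k"
      using order_ideal_mult[OF prod(1), of _ 0] by simp_all
    moreover have "g \<otimes>\<^bsub>O2\<^esub> f = (g * u) * a + (g * v) * b" using uv by (simp add: algebra_simps)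
    ultimately show ?case by blast
  next
    case (sum x y)
    then obtain g h g' h' where "x = g * a + h * b" "y = g' * a + h' * b"
      "g \<in> order_ideal k" "h \<in> order_ideal k" "g' \<in> order_ideal k" "h' \<in> order_ideal k" by blast
    then have "x \<oplus>\<^bsub>O2\<^esub> y = (g + g') * a + (h + h') * b" "g + g' \<in> order_ideal k" "h + h' \<in> order_ideal k"
      by (auto simp: algebra_simps mem_order_ideal convergent2_add)
    then show ?case by blast
  qed
next
  fix f assume "f \<in> ?MJ"
  then obtain g h where "f = g * a + h * b" "g \<in> order_ideal k" "h \<in> order_ideal k" by blast
  moreover have "a \<in> Idl\<^bsub>O2\<^esub> {a, b}" "b \<in> Idl\<^bsub>O2\<^esub> {a, b}"
    using O2.genideal_self[of "{a, b}"] assms by auto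
  ultimately show "f \<in> order_ideal k \<cdot>\<^bsub>O2\<^esub> (Idl\<^bsub>O2\<^esub> {a, b})"
    using ideal_prod.sum[OF ideal_prod.prod ideal_prod.prod, of g _ a _ h b O2] by auto
qed

section \<open>Series in one variable inside an ideal of finite codimension\<close>

lemma finite_codim_meets_subspace:
  assumes "relative_dim scale2 J n (carrier O2)" "series.subspace J" "series.subspace X" "X \<subseteq> carrier O2"
    and "\<And>i. \<exists>Y\<subseteq>X. relative_dim scale2 {0} i Y"
  shows "\<exists>P\<in>X \<inter> J. P \<noteq> 0"
proof (rule ccontr)
  assume "\<not> ?thesis"
  then have XJ: "X \<inter> J \<subseteq> {0}" by blast
  \<comment> \<open>If \<open>X\<close> meets \<open>J\<close> only in 0, it embeds into the
    quotient by \<open>J\<close>; a chain of length \<open>n + 1\<close> inside \<open>X\<close>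
    then exceeds the codimension \<open>n\<close>.\<close>
  obtain Y where Y: "Y \<subseteq> X" "relative_dim scale2 {0} (Suc n) Y" using assms(5) by blast
  let ?Z = "{t + x | t x. t \<in> J \<and> x \<in> Y}"
  have "relative_dim scale2 J (Suc n) ?Z"
  proof (rule relative_dim_image[of scale2 scale2 "\<lambda>x. x", OF series.linear_id[unfolded id_def] Y(2) _ assms(2)])
    show "series.subspace {0}" by (rule series.subspace_single_0)
    show "x \<in> J \<longleftrightarrow> x \<in> {0}" if "x \<in> Y" for x
      using that XJ Y(1) series.subspace_0[OF assms(2)] by blast
  qed
  moreover have "?Z \<subseteq> carrier O2"
    using series.relative_dim_subset[OF assms(1)] Y(1) assms(4) series.subspace_add[OF subspace_carrier] by blast
  ultimately have "Suc n \<le> n"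
    using series.relative_dim_mono[OF assms(1) _ assms(2)] by blast
  then show False by simp
qed


text \<open>Any \<open>i\<close> monomials with exponents in \<open>L\<close> span a suitable
  \<open>Y\<close>.\<close>

lemma relative_dim_axis:
  assumes "infinite L"
  shows "\<exists>Y\<subseteq>vanishing_on (- L). relative_dim scale2 {0} i Y"
proof -
  obtain B where B: "B \<subseteq> L" "finite B" "card B = i"
    using infinite_arbitrarily_large[OF assms] by blast
  have "- B \<union> B = UNIV" by auto
  then have "relative_dim scale2 {0} i (vanishing_on (- B))"
    using relative_dim_vanishing_on[OF B(2), of "- B"] B(3) by (simp add: vanishing_on_UNIV)
  moreover have "vanishing_on (- B) \<subseteq> vanishing_on (- L)" using B(1) by (auto simp: vanishing_on_def)
  ultimately show ?thesis by blast
qed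

lemma finite_codim_meets_vanishing_on:
  assumes "relative_dim scale2 J n (carrier O2)" "series.subspace J" "infinite L"
  shows "\<exists>P\<in>J. P \<noteq> 0 \<and> (\<forall>i j. (i, j) \<notin> L \<longrightarrow> coeff2 P i j = 0)"
proof -
  have "vanishing_on (- L) \<subseteq> carrier O2" by (auto simp: vanishing_on_def)
  from finite_codim_meets_subspace[OF assms(1,2) subspace_vanishing_on this relative_dim_axis[OF assms(3)]]
  obtain P where "P \<in> vanishing_on (- L)" "P \<in> J" "P \<noteq> 0" by blast
  then show ?thesis by (auto simp: vanishing_on_def)
qed

section \<open>Syzygies\<close>

text \<open>\<open>P\<close> is a power of \<open>x\<close> times a unit, while \<open>Q\<close> is
  a nonzero constant with respect to the outer variable \<open>x\<close>; so a power of
  \<open>x\<close> that divides \<open>r * Q\<close> already divides \<open>r\<close>.\<close>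

lemma dvd_of_axis_series:
  assumes P: "P \<noteq> 0" "\<And>i j. j \<noteq> 0 \<Longrightarrow> coeff2 P i j = 0"
    and Q: "Q \<noteq> 0" "\<And>i j. i \<noteq> 0 \<Longrightarrow> coeff2 Q i j = 0"
    and eq: "r * Q = s * P"
  shows "P dvd r"
proof (cases "r = 0")
  case False
  define n where "n = subdegree P"
  define U where "U = fps_shift n P"
  have PU: "P = U * fps_X ^ n" unfolding U_def n_def by (rule subdegree_decompose)
  have "fps_nth P n \<noteq> 0" using P(1) unfolding n_def by (rule nth_subdegree_nonzero)
  \<comment> \<open>The lowest \<open>x\<close>-coefficient of \<open>P\<close> is constant in
    \<open>y\<close> and nonzero, hence a unit; this makes \<open>U\<close> invertible.\<close>
  moreover have "fps_nth P n = fps_const (coeff2 P n 0)"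
    using P(2)[of _ n] by (auto simp: fps_eq_iff coeff2_def)
  ultimately have "fps_nth U 0 * fps_const (inverse (coeff2 P n 0)) = 1"
    by (auto simp: U_def)
  then obtain V where V: "U * V = 1" using fps_right_inverse by blast
  have "Q = fps_const (fps_nth Q 0)"
    using Q(2) by (auto simp: fps_eq_iff coeff2_def)
  moreover from this Q(1) have Q0: "fps_nth Q 0 \<noteq> 0" by (metis fps_const_0_eq_0)
  ultimately have eq': "r * fps_const (fps_nth Q 0) = (s * U) * fps_X ^ n"
    using eq PU by (metis mult.assoc)
  have "fps_nth r i = 0" if "i < n" for i
  proof -
    have "fps_nth r i * fps_nth Q 0 = fps_nth (r * fps_const (fps_nth Q 0)) i" by simp
    also have "\<dots> = 0" unfolding eq' using that by (simp add: fps_X_power_mult_right_nth)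
    finally show ?thesis using Q0 by simp
  qed
  then have "n \<le> subdegree r" using False by (intro subdegree_geI) auto
  then have "r = fps_shift n r * fps_X ^ n" by (rule fps_shift_times_fps_X_power[symmetric])
  also have "\<dots> = (fps_shift n r * fps_X ^ n) * (U * V)" using V by simp
  also have "\<dots> = P * (fps_shift n r * V)" unfolding PU by (simp add: mult_ac)
  finally show ?thesis by (rule dvdI)
qed auto

lemma koszul_syzygy:
  assumes P: "\<alpha> * a + \<beta> * b \<noteq> 0" "\<And>i j. j \<noteq> 0 \<Longrightarrow> coeff2 (\<alpha> * a + \<beta> * b) i j = 0"
    and Q: "\<gamma> * a + \<delta> * b \<noteq> 0" "\<And>i j. i \<noteq> 0 \<Longrightarrow> coeff2 (\<gamma> * a + \<delta> * b) i j = 0"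
    and gh: "g * a + h * b = 0"
  obtains q where "g = q * b" "h = - (q * a)"
proof -
  define p where "p = \<alpha> * a + \<beta> * b"
  define p' where "p' = \<gamma> * a + \<delta> * b"
  define r where "r = \<beta> * g - \<alpha> * h"
  define s where "s = \<delta> * g - \<gamma> * h"
  have ga: "g * a = - (h * b)" using gh by (simp add: eq_neg_iff_add_eq_0)
  have hb: "h * b = - (g * a)" using ga by simp
  have "g * p = \<alpha> * (g * a) + b * (\<beta> * g)" "g * p' = \<gamma> * (g * a) + b * (\<delta> * g)"
    by (simp_all add: p_def p'_def algebra_simps)
  then have g: "g * p = b * r" "g * p' = b * s"
    unfolding ga by (simp_all add: r_def s_def algebra_simps)
  have "h * p = a * (\<alpha> * h) + \<beta> * (h * b)" "h * p' = a * (\<gamma> * h) + \<delta> * (h * b)"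
    by (simp_all add: p_def p'_def algebra_simps)
  then have h: "h * p = - (a * r)" "h * p' = - (a * s)"
    unfolding hb by (simp_all add: r_def s_def algebra_simps)
  have "b * (r * p') = (g * p) * p'" unfolding g(1) by (simp add: mult_ac)
  also have "\<dots> = (g * p') * p" by (simp add: mult_ac)
  also have "\<dots> = b * (s * p)" unfolding g(2) by (simp add: mult_ac)
  finally have "b * (r * p') = b * (s * p)" .
  moreover have "a * (r * p') = - ((h * p) * p')" unfolding h(1) by (simp add: mult_ac)
  then have "a * (r * p') = - ((h * p') * p)" by (simp add: mult_ac)
  then have "a * (r * p') = a * (s * p)" unfolding h(2) by (simp add: mult_ac)
  \<comment> \<open>Whichever of \<open>a\<close> and \<open>b\<close> is nonzero is cancelled; they
    cannot both vanish because \<open>p\<close> is nonzero.\<close>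
  moreover have "a \<noteq> 0 \<or> b \<noteq> 0" using P(1) by auto
  ultimately have "r * p' = s * p" by auto
  then have "p dvd r"
    using dvd_of_axis_series[of p p' r s] P Q unfolding p_def p'_def by blast
  then obtain q where q: "r = p * q" by (rule dvdE)
  have "p * g = p * (q * b)" "p * h = p * (- (q * a))"
    using g(1) h(1) unfolding q by (simp_all add: mult_ac)
  moreover have "p \<noteq> 0" using P(1) unfolding p_def .
  ultimately show ?thesis using that[of q] by (simp only: mult_left_cancel simp_thms)
qed

lemma convergent2_finite_support:
  assumes "finite {(i, j). coeff2 f i j \<noteq> 0}"
  shows "convergent2 f"
proof (rule convergent2I[of 1])
  fix i j
  let ?S = "{(i, j). coeff2 f i j \<noteq> 0}"
  show "norm (coeff2 f i j) \<le> (\<Sum>(i, j)\<in>?S. norm (coeff2 f i j)) * 1 ^ (i + j)"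
  proof (cases "(i, j) \<in> ?S")
    case True
    from member_le_sum[OF this _ assms, of "\<lambda>(i, j). norm (coeff2 f i j)"]
    show ?thesis by auto
  next
    case False
    have "0 \<le> (\<Sum>(i, j)\<in>?S. norm (coeff2 f i j))" by (rule sum_nonneg) auto
    with False show ?thesis by simp
  qed
qed simp

text \<open>The Koszul factor is only a formal series; this makes it convergent at the cost of an error of order \<open>k\<close>.\<close>

lemma truncate2E:
  obtains q' where "convergent2 q'" "\<And>i j. i + j < k \<Longrightarrow> coeff2 (q - q') i j = 0"
proof -
  define q' where "q' = Abs_fps (\<lambda>i. Abs_fps (\<lambda>j. if i + j < k then coeff2 q i j else 0))"
  have "finite {(i, j). coeff2 q' i j \<noteq> 0}"
    by (rule finite_subset[OF _ finite_triangle[of k]]) (auto simp: q'_def split: if_splits)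
  then show ?thesis
    by (intro that[of q'] convergent2_finite_support) (auto simp: q'_def)
qed

section \<open>Dimension count\<close>

definition scale_pair :: "complex \<Rightarrow> complex fps fps \<times> complex fps fps \<Rightarrow> complex fps fps \<times> complex fps fps" where
  "scale_pair c p = (scale2 c (fst p), scale2 c (snd p))"

interpretation pair: vector_space scale_pair
  by unfold_locales
    (simp_all add: scale_pair_def series.scale_right_distrib series.scale_left_distrib)

lemma subspace_Times:
  "series.subspace A \<Longrightarrow> series.subspace B \<Longrightarrow> pair.subspace (A \<times> B)"
  by (rule pair.subspaceI)
    (auto simp: scale_pair_def zero_prod_def intro: series.subspace_0 series.subspace_add series.subspace_scale)

lemma scale2_mult_left: "scale2 c f * g = scale2 c (f * g)"
  by (simp add: scale2_def mult.assoc)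

lemma scale2_mult_right: "g * scale2 c f = scale2 c (g * f)"
  by (simp add: scale2_def mult_ac)

text \<open>The chain runs from \<open>I \<times> I\<close> through \<open>W \<times> I\<close> to
  \<open>W \<times> W\<close>, one coordinate at a time.\<close>

lemma relative_dim_Times:
  assumes "relative_dim scale2 I n W" "series.subspace I" "series.subspace W"
  shows "relative_dim scale_pair (I \<times> I) (n + n) (W \<times> W)"
proof -
  have "Vector_Spaces.linear scale2 scale_pair (\<lambda>x. (x, 0))"
    by unfold_locales (auto simp: scale_pair_def)
  from relative_dim_image[OF this assms(1,2) subspace_Times[OF assms(2,2)]]
  have "relative_dim scale_pair (I \<times> I) n {t + (x, 0) | t x. t \<in> I \<times> I \<and> x \<in> W}"
    using series.subspace_0[OF assms(2)] by auto
  also have "{t + (x, 0) | t x. t \<in> I \<times> I \<and> x \<in> W} = W \<times> I"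
  proof (intro equalityI subsetI)
    fix z assume z: "z \<in> W \<times> I"
    then have "z = (0, snd z) + (fst z, 0)" "(0, snd z) \<in> I \<times> I" "fst z \<in> W"
      using series.subspace_0[OF assms(2)] by auto
    then show "z \<in> {t + (x, 0) | t x. t \<in> I \<times> I \<and> x \<in> W}" by blast
  next
    fix z assume "z \<in> {t + (x, 0) | t x. t \<in> I \<times> I \<and> x \<in> W}"
    then show "z \<in> W \<times> I"
      using series.subspace_add[OF assms(3)] series.relative_dim_subset[OF assms(1)] by auto
  qed
  finally have 1: "relative_dim scale_pair (I \<times> I) n (W \<times> I)" .
  have "Vector_Spaces.linear scale2 scale_pair (\<lambda>x. (0, x))"
    by unfold_locales (auto simp: scale_pair_def)
  from relative_dim_image[OF this assms(1,2) subspace_Times[OF assms(3,2)]]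
  have "relative_dim scale_pair (W \<times> I) n {t + (0, x) | t x. t \<in> W \<times> I \<and> x \<in> W}"
    using series.subspace_0[OF assms(3)] by auto
  also have "{t + (0, x) | t x. t \<in> W \<times> I \<and> x \<in> W} = W \<times> W"
  proof (intro equalityI subsetI)
    fix z assume z: "z \<in> W \<times> W"
    then have "z = (fst z, 0) + (0, snd z)" "(fst z, 0) \<in> W \<times> I" "snd z \<in> W"
      using series.subspace_0[OF assms(2)] by auto
    then show "z \<in> {t + (0, x) | t x. t \<in> W \<times> I \<and> x \<in> W}" by blast
  next
    fix z assume "z \<in> {t + (0, x) | t x. t \<in> W \<times> I \<and> x \<in> W}"
    then show "z \<in> W \<times> W"
      using series.subspace_add[OF assms(3)] series.relative_dim_subset[OF assms(1)] by auto
  qed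
  finally have "relative_dim scale_pair (W \<times> I) n (W \<times> W)" .
  then show ?thesis using relative_dim_trans 1 by blast
qed

lemma syzygies_mod_order_ideal:
  assumes a: "convergent2 a" and b: "convergent2 b"
    and fin: "relative_dim scale2 (Idl\<^bsub>O2\<^esub> {a, b}) n (carrier O2)"
    and gh: "convergent2 g" "convergent2 h" "g * a + h * b = 0"
  obtains q where "convergent2 q" "g - q * b \<in> order_ideal k" "h + q * a \<in> order_ideal k"
proof -
  have J: "series.subspace (Idl\<^bsub>O2\<^esub> {a, b})"
    using a b by (intro subspace_ideal O2.genideal_ideal) auto
  have J_eq: "Idl\<^bsub>O2\<^esub> {a, b} = {g * a + h * b | g h. g \<in> carrier O2 \<and> h \<in> carrier O2}"
    using a b by (intro genideal_pair) auto
  have "inj (\<lambda>i::nat. (i, 0::nat))" "inj (\<lambda>j::nat. (0::nat, j))" by (auto intro: injI)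
  \<comment> \<open>These exponent sets are the two axes; series supported on them are the series in
    \<open>x\<close> alone and in \<open>y\<close> alone.\<close>
  then have inf: "infinite (range (\<lambda>i::nat. (i, 0::nat)))" "infinite (range (\<lambda>j::nat. (0::nat, j)))"
    using range_inj_infinite by blast+
  obtain P where P: "P \<in> Idl\<^bsub>O2\<^esub> {a, b}" "P \<noteq> 0"
      "\<And>i j. (i, j) \<notin> range (\<lambda>i::nat. (i, 0::nat)) \<Longrightarrow> coeff2 P i j = 0"
    using finite_codim_meets_vanishing_on[OF fin J inf(1)] by blast
  obtain Q where Q: "Q \<in> Idl\<^bsub>O2\<^esub> {a, b}" "Q \<noteq> 0"
      "\<And>i j. (i, j) \<notin> range (\<lambda>j::nat. (0::nat, j)) \<Longrightarrow> coeff2 Q i j = 0"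
    using finite_codim_meets_vanishing_on[OF fin J inf(2)] by blast
  obtain \<alpha> \<beta> where P_eq: "P = \<alpha> * a + \<beta> * b" using P(1) unfolding J_eq by blast
  obtain \<gamma> \<delta> where Q_eq: "Q = \<gamma> * a + \<delta> * b" using Q(1) unfolding J_eq by blast
  have P3: "coeff2 P i j = 0" if "j \<noteq> 0" for i j using that by (intro P(3)) auto
  have Q3: "coeff2 Q i j = 0" if "i \<noteq> 0" for i j using that by (intro Q(3)) auto
  obtain q where q: "g = q * b" "h = - (q * a)"
    by (rule koszul_syzygy[OF P(2)[unfolded P_eq] P3[unfolded P_eq] Q(2)[unfolded Q_eq] Q3[unfolded Q_eq] gh(3)])
  obtain q' where q': "convergent2 q'" "\<And>i j. i + j < k \<Longrightarrow> coeff2 (q - q') i j = 0"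
    using truncate2E[of k q] by blast
  have "g - q' * b \<in> order_ideal k" "h + q' * a \<in> order_ideal k"
  proof -
    have "convergent2 (g - q' * b)" "convergent2 (h + q' * a)"
      using gh a b q' by (auto intro: convergent2_diff convergent2_add convergent2_mult)
    \<comment> \<open>The errors are multiples of \<open>q - q'\<close>, up to sign, and this series
      has order at least \<open>k\<close>.\<close>
    moreover have "g - q' * b = (q - q') * b" "h + q' * a = (q' - q) * a"
      unfolding q by (simp_all add: algebra_simps)
    moreover have "coeff2 (q' - q) i j = 0" if "i + j < k" for i j
      using q'(2)[OF that] by simp
    ultimately show "g - q' * b \<in> order_ideal k" "h + q' * a \<in> order_ideal k"
      using coeff2_mult_eq_0[of k "q - q'" 0 b] coeff2_mult_eq_0[of k "q' - q" 0 a] q'(2)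
      by (auto simp: mem_order_ideal)
  qed
  with q'(1) show ?thesis by (rule that)
qed

text \<open>Powers of an ideal in the monoid of ideals are ideals.\<close>

lemma ideal_order_ideal: "ideal (order_ideal k) O2"
proof -
  have "max_ideal \<in> carrier (ideals_set O2)" by (simp add: ideals_set_def ideal_max_ideal)
  from monoid.nat_pow_closed[OF comm_monoid.axioms(1)[OF O2.ideals_set_is_comm_monoid] this]
  show ?thesis by (simp add: max_ideal_power) (simp add: ideals_set_def)
qed

text \<open>In the application \<open>p\<close> is \<open>m - 1\<close>, the smaller order of the
  two partial derivatives. The bound in the second conclusion makes the truncated subtraction in the
  first one genuine.\<close>

lemma relative_dim_order_ideal_prod:
  assumes a: "convergent2 a" and b: "convergent2 b"
    and fin: "relative_dim scale2 (Idl\<^bsub>O2\<^esub> {a, b}) n (carrier O2)"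
    and ord: "\<And>q. convergent2 q \<Longrightarrow>
      q * a \<in> order_ideal k \<and> q * b \<in> order_ideal k \<longleftrightarrow> q \<in> order_ideal (k - p)"
  shows "relative_dim scale2 (order_ideal k \<cdot>\<^bsub>O2\<^esub> (Idl\<^bsub>O2\<^esub> {a, b}))
      (k * (k + 1) - (k - p) * (k - p + 1) div 2 + n) (carrier O2)"
    and "(k - p) * (k - p + 1) div 2 \<le> k * (k + 1)"
proof -
  define J where "J = Idl\<^bsub>O2\<^esub> {a, b}"
  define M where "M = order_ideal k"
  define MJ where "MJ = M \<cdot>\<^bsub>O2\<^esub> J"
  define e where "e = (k - p) * (k - p + 1) div 2"
  let ?O = "carrier O2"
  let ?\<psi> = "\<lambda>q. (q * b, - (q * a))"
  let ?\<phi> = "\<lambda>x. fst x * a + snd x * b"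
  \<comment> \<open>\<open>S\<close> will turn out to be the preimage of \<open>MJ\<close> under
    \<open>?\<phi>\<close>: pairs from \<open>M\<close> plus multiples of
    \<open>(b, - a)\<close>.\<close>
  define S where "S = {t + ?\<psi> q | t q. t \<in> M \<times> M \<and> q \<in> ?O}"
  have ab: "a \<in> ?O" "b \<in> ?O" using a b by auto
  have sM: "series.subspace M" unfolding M_def order_ideal_def by (rule subspace_vanishing_on)
  have J_eq: "J = {g * a + h * b | g h. g \<in> ?O \<and> h \<in> ?O}"
    unfolding J_def by (rule genideal_pair[OF ab])
  have MJ_eq: "MJ = {g * a + h * b | g h. g \<in> M \<and> h \<in> M}"
    unfolding MJ_def M_def J_def by (rule order_ideal_prod_genideal_pair[OF ab])
  have MO: "M \<subseteq> ?O" unfolding M_def by (auto simp: mem_order_ideal)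
  have uminus_M: "- f \<in> M" if "f \<in> M" for f using that sM by (rule series.subspace_neg[rotated])

  have "relative_dim scale2 M (k * (k + 1) div 2) ?O"
    unfolding M_def by (rule relative_dim_order_ideal)
  from relative_dim_Times[OF this sM subspace_carrier]
  have dim_OO: "relative_dim scale_pair (M \<times> M) (k * (k + 1)) (?O \<times> ?O)"
    by (simp flip: mult_2)

  have "Vector_Spaces.linear scale2 scale_pair ?\<psi>"
    by unfold_locales (auto simp: scale_pair_def scale2_mult_right scale2_mult_left series.scale_minus_right algebra_simps)
  \<comment> \<open>Modulo \<open>M \<times> M\<close> the kernel of \<open>?\<psi>\<close> is the
    order ideal of exponent \<open>k - p\<close>, whose codimension is \<open>e\<close>.\<close>
  moreover have "?\<psi> q \<in> M \<times> M \<longleftrightarrow> q \<in> order_ideal (k - p)" if "q \<in> ?O" for q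
    using ord[of q] that uminus_M[of "q * a"] uminus_M[of "- (q * a)"] by (auto simp: M_def)
  moreover have "series.subspace (order_ideal (k - p))"
    unfolding order_ideal_def by (rule subspace_vanishing_on)
  ultimately have dim_S: "relative_dim scale_pair (M \<times> M) e S"
    unfolding S_def e_def
    by (intro relative_dim_image[OF _ relative_dim_order_ideal] subspace_Times sM)
  have sMM: "pair.subspace (M \<times> M)" by (rule subspace_Times[OF sM sM])
  have sS: "pair.subspace S" by (rule pair.relative_dim_subspace[OF dim_S sMM])
  have SO: "S \<subseteq> ?O \<times> ?O"
    unfolding S_def using MO a b by (force intro: convergent2_add convergent2_diff convergent2_mult)
  obtain n' where n'_OO: "relative_dim scale_pair S n' (?O \<times> ?O)"
    using pair.relative_dim_larger_base[OF dim_OO sMM sS] pair.relative_dim_subset[OF dim_S] SO by blast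
  \<comment> \<open>The chain from \<open>M \<times> M\<close> through \<open>S\<close> to the whole
    square has length \<open>e + n'\<close>, and codimension is unique.\<close>
  have sum: "e + n' = k * (k + 1)"
    using pair.relative_dim_unique[OF relative_dim_trans[OF n'_OO dim_S] dim_OO sMM] .

  have iJ: "ideal J O2" unfolding J_def by (rule O2.genideal_ideal) (use a b in auto)
  have iMJ: "ideal MJ O2"
    unfolding MJ_def M_def by (rule O2.ideal_prod_is_ideal[OF ideal_order_ideal iJ])
  have sMJ: "series.subspace MJ" by (rule subspace_ideal[OF iMJ])
  have sJ: "series.subspace J" by (rule subspace_ideal[OF iJ])
  have MJ_J: "MJ \<subseteq> J" unfolding MJ_eq J_eq using MO by blast

  have "Vector_Spaces.linear scale_pair scale2 ?\<phi>"
    by unfold_locales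
      (auto simp: scale_pair_def scale2_mult_right scale2_mult_left series.scale_right_distrib algebra_simps)
  moreover have "?\<phi> x \<in> MJ \<longleftrightarrow> x \<in> S" if x: "x \<in> ?O \<times> ?O" for x
  proof
    assume "?\<phi> x \<in> MJ"
    \<comment> \<open>Subtracting a pair from \<open>M \<times> M\<close> with the same image leaves
      a genuine syzygy, hence a multiple of \<open>(b, - a)\<close> up to
      \<open>M \<times> M\<close>.\<close>
    then obtain g h where gh: "?\<phi> x = g * a + h * b" "g \<in> M" "h \<in> M" unfolding MJ_eq by blast
    have "g \<in> ?O" "h \<in> ?O" using gh MO by blast+
    then have "convergent2 (fst x - g)" "convergent2 (snd x - h)"
      using x by (auto intro: convergent2_diff)
    moreover have "(fst x - g) * a + (snd x - h) * b = 0" using gh(1) by (simp add: algebra_simps)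
    ultimately obtain q where q: "convergent2 q" "fst x - g - q * b \<in> M" "snd x - h + q * a \<in> M"
      unfolding M_def by (rule syzygies_mod_order_ideal[OF a b fin])
    have "g + (fst x - g - q * b) \<in> M" "h + (snd x - h + q * a) \<in> M"
      using gh q sM by (blast intro: series.subspace_add)+
    moreover have "x = (g + (fst x - g - q * b), h + (snd x - h + q * a)) + ?\<psi> q"
      by (simp add: prod_eq_iff)
    ultimately show "x \<in> S" unfolding S_def using q(1) by fastforce
  next
    assume "x \<in> S"
    then obtain g h q where "x = (g, h) + ?\<psi> q" "g \<in> M" "h \<in> M" unfolding S_def by blast
    moreover from this have "?\<phi> x = g * a + h * b" by (simp add: algebra_simps)
    ultimately show "?\<phi> x \<in> MJ" unfolding MJ_eq by blast
  qed
  \<comment> \<open>Thus \<open>MJ\<close> has in the image of \<open>?\<phi>\<close>, which is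
    \<open>J\<close>, the codimension that \<open>S\<close> has in the square.\<close>
  ultimately have "relative_dim scale2 MJ n' {t + ?\<phi> x | t x. t \<in> MJ \<and> x \<in> ?O \<times> ?O}"
    by (intro relative_dim_image[OF _ n'_OO sS sMJ])
  also have "{t + ?\<phi> x | t x. t \<in> MJ \<and> x \<in> ?O \<times> ?O} = J"
  proof
    have "?\<phi> x \<in> J" if "x \<in> ?O \<times> ?O" for x
      using mem_Times_iff[THEN iffD1, OF that] unfolding J_eq by blast
    then show "{t + ?\<phi> x | t x. t \<in> MJ \<and> x \<in> ?O \<times> ?O} \<subseteq> J"
      using MJ_J series.subspace_add[OF sJ] by blast
    show "J \<subseteq> {t + ?\<phi> x | t x. t \<in> MJ \<and> x \<in> ?O \<times> ?O}"
    proof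
      fix f assume "f \<in> J"
      then obtain g h where "f = 0 + ?\<phi> (g, h)" "(g, h) \<in> ?O \<times> ?O" unfolding J_eq by auto
      then show "f \<in> {t + ?\<phi> x | t x. t \<in> MJ \<and> x \<in> ?O \<times> ?O}"
        using series.subspace_0[OF sMJ] by blast
    qed
  qed
  finally have "relative_dim scale2 MJ (n' + n) ?O"
    using relative_dim_trans[OF fin[folded J_def]] by blast
  moreover have "n' = k * (k + 1) - e" using sum by simp
  ultimately show "relative_dim scale2 (order_ideal k \<cdot>\<^bsub>O2\<^esub> (Idl\<^bsub>O2\<^esub> {a, b}))
      (k * (k + 1) - (k - p) * (k - p + 1) div 2 + n) ?O"
    unfolding MJ_def M_def J_def e_def by simp
  show "(k - p) * (k - p + 1) div 2 \<le> k * (k + 1)" using sum unfolding e_def by linarith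
qed

section \<open>The multiplicity of \<open>f\<close> and the orders of its partial
  derivatives\<close>

lemma multiplicity0_eq_enatD:
  assumes "multiplicity0 f = enat m"
  shows "\<exists>i j. i + j = m \<and> coeff2 f i j \<noteq> 0" "\<And>i j. i + j < m \<Longrightarrow> coeff2 f i j = 0"
proof -
  let ?A = "{enat (i + j) | i j. coeff2 f i j \<noteq> 0}"
  \<comment> \<open>The infimum of the empty set in \<open>enat\<close> is
    \<open>\<infinity>\<close>, so a finite multiplicity is attained by some monomial.\<close>
  have "?A \<noteq> {}"
  proof
    assume "?A = {}"
    then have "multiplicity0 f = \<infinity>" unfolding multiplicity0_def by (simp only: Inf_empty top_enat_def)
    with assms show False by simp
  qed
  then obtain n where "n \<in> ?A" by (meson ex_in_conv)
  then have "Inf ?A \<in> ?A" by (rule wellorder_InfI)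
  then show "\<exists>i j. i + j = m \<and> coeff2 f i j \<noteq> 0"
    using assms unfolding multiplicity0_def by auto
  fix i j :: nat assume ij: "i + j < m"
  show "coeff2 f i j = 0"
  proof (rule ccontr)
    assume "coeff2 f i j \<noteq> 0"
    then have "Inf ?A \<le> enat (i + j)" by (intro Inf_lower) blast
    then show False using ij assms unfolding multiplicity0_def by simp
  qed
qed

text \<open>In characteristic 0 some partial derivative of a lowest monomial is nonzero, so one of
  the two series has order exactly \<open>m - 1\<close> and bounds the order of \<open>q\<close>
  from below. The converse holds because both have order at least \<open>m - 1\<close>.\<close>

lemma mult_jacobian_mem_order_ideal_iff:
  assumes f: "convergent2 f" "multiplicity0 f = enat m" "m \<ge> 1" and q: "convergent2 q"
  shows "q * deriv_x f \<in> order_ideal k \<and> q * deriv_y f \<in> order_ideal k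
    \<longleftrightarrow> q \<in> order_ideal (k - (m - 1))"
proof -
  note conv = convergent2_deriv[OF f(1)]
  obtain i j where ij: "i + j = m" "coeff2 f i j \<noteq> 0" using multiplicity0_eq_enatD(1)[OF f(2)] by blast
  have low: "coeff2 (deriv_x f) i j = 0" "coeff2 (deriv_y f) i j = 0" if "i + j < m - 1" for i j
    using that multiplicity0_eq_enatD(2)[OF f(2)] by auto
  have mem: "q * g \<in> order_ideal k"
    if "q \<in> order_ideal (k - (m - 1))" "convergent2 g" "\<And>i j. i + j < m - 1 \<Longrightarrow> coeff2 g i j = 0" for g
  proof -
    have "q * g \<in> order_ideal (k - (m - 1) + (m - 1))"
      using that by (intro order_ideal_mult) (auto simp: mem_order_ideal)
    then show ?thesis by (auto simp: mem_order_ideal)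
  qed
  show ?thesis
  proof (cases i)
    case (Suc i')
    have eq: "m - 1 = i' + j" using ij Suc by simp
    have "coeff2 (deriv_x f) i' j \<noteq> 0" using ij Suc by (simp del: of_nat_Suc)
    from mult_mem_order_ideal_iff[OF conv(1) this low(1)[unfolded eq] q, of k]
    show ?thesis using mem[OF _ conv(2) low(2)] unfolding eq by blast
  next
    case 0
    \<comment> \<open>The lowest monomial is here a pure power of \<open>y\<close>, of positive
      exponent since \<open>m \<ge> 1\<close>, so the derivative in \<open>y\<close> takes
      over.\<close>
    then obtain j' where j': "j = Suc j'" using ij f(3) by (cases j) auto
    have eq: "m - 1 = i + j'" using ij j' by simp
    have "coeff2 (deriv_y f) i j' \<noteq> 0" using ij j' by (simp del: of_nat_Suc)
    from mult_mem_order_ideal_iff[OF conv(2) this low(2)[unfolded eq] q, of k]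
    show ?thesis using mem[OF _ conv(1) low(1)] unfolding eq by blast
  qed
qed

theorem corollary4p1:
  fixes f :: "complex fps fps" and m k :: nat
  assumes "f \<in> carrier O2"
    and "isolated_singularity f"
    and "multiplicity0 f = enat m"
    and "m \<ge> 1"
  shows "milnor_number_k k f =
    (if k < m then milnor_number f + enat (k * (k + 1))
     else milnor_number f + enat (k * (k + 1)) - enat ((k - m + 2) * (k - m + 1) div 2))"
proof -
  have f: "convergent2 f" using assms(1) by simp
  note conv = convergent2_deriv[OF f]
  define J where "J = jacobian_ideal f"
  define MJ where "MJ = order_ideal k \<cdot>\<^bsub>O2\<^esub> J"
  have J_eq: "J = Idl\<^bsub>O2\<^esub> {deriv_x f, deriv_y f}" by (simp add: J_def jacobian_ideal_def)
  have iJ: "ideal J O2" unfolding J_def by (rule ideal_jacobian_ideal[OF assms(1)])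
  have iM: "ideal (order_ideal k) O2" by (rule ideal_order_ideal)
  have iMJ: "ideal MJ O2" unfolding MJ_def by (rule O2.ideal_prod_is_ideal[OF iM iJ])
  have MJ_J: "MJ \<subseteq> J" unfolding MJ_def using O2.ideal_prod_inter[OF iM iJ] by blast
  have mk: "milnor_number_k k f = quot_dim MJ"
    by (simp add: milnor_number_k_def max_ideal_power MJ_def J_def)
  have m0: "milnor_number f = quot_dim J" by (simp add: milnor_number_def J_def)
  show ?thesis
  proof (cases "\<exists>n. relative_dim scale2 J n (carrier O2)")
    case True
    then obtain n where n: "relative_dim scale2 J n (carrier O2)" by blast
    define e where "e = (k - (m - 1)) * (k - (m - 1) + 1) div 2"
    note dim = relative_dim_order_ideal_prod[OF conv n[unfolded J_eq]
        mult_jacobian_mem_order_ideal_iff[OF f assms(3,4)], of k, folded J_eq MJ_def e_def]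
    \<comment> \<open>Subtraction truncates, so this reordering rests on
      \<open>e \<le> k * (k + 1)\<close>.\<close>
    have "k * (k + 1) - e + n = n + k * (k + 1) - e" using dim(2) by linarith
    moreover have "milnor_number_k k f = enat (k * (k + 1) - e + n)"
      unfolding mk by (rule quot_dim_eq[OF iMJ dim(1)])
    ultimately have "milnor_number_k k f = enat n + enat (k * (k + 1)) - enat e"
      by (simp only: plus_enat_simps idiff_enat_enat)
    moreover have "milnor_number f = enat n" unfolding m0 by (rule quot_dim_eq[OF iJ n])
    ultimately have eq: "milnor_number_k k f = milnor_number f + enat (k * (k + 1)) - enat e"
      by (simp only:)
    show ?thesis
    proof (cases "k < m")
      case True
      \<comment> \<open>For \<open>k < m\<close> the difference \<open>k - (m - 1)\<close> truncates
        to 0, so the same \<open>e\<close> serves both cases of the formula.\<close>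
      then have "e = 0" by (simp add: e_def)
      then show ?thesis unfolding eq using True by (simp add: zero_enat_def[symmetric])
    next
      case False
      then have "k - (m - 1) = k - m + 1" using assms(4) by simp
      then have "e = (k - m + 2) * (k - m + 1) div 2" by (simp add: e_def mult.commute)
      then show ?thesis unfolding eq using False by (simp only: if_False)
    qed
  next
    case False
    \<comment> \<open>Since \<open>MJ\<close> is contained in \<open>J\<close>, finite codimension
      of \<open>MJ\<close> would give that of \<open>J\<close>.\<close>
    have "\<nexists>n. relative_dim scale2 MJ n (carrier O2)"
    proof
      assume "\<exists>n. relative_dim scale2 MJ n (carrier O2)"
      then obtain n where "relative_dim scale2 MJ n (carrier O2)" by blast
      from series.relative_dim_larger_base[OF this subspace_ideal[OF iMJ] subspace_ideal[OF iJ] MJ_J]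
      show False using False ideal.Icarr[OF iJ] by blast
    qed
    then have "milnor_number_k k f = \<infinity>" unfolding mk by (rule quot_dim_eq_infinity[OF iMJ])
    \<comment> \<open>In \<open>enat\<close>, adding or subtracting a finite value leaves
      \<open>\<infinity>\<close> unchanged, so both cases of the formula read
      \<open>\<infinity> = \<infinity>\<close>.\<close>
    moreover have "milnor_number f = \<infinity>" unfolding m0 by (rule quot_dim_eq_infinity[OF iJ False])
    ultimately show ?thesis by simp
  qed
qed

end
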